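(* Let $p\in(0,1)$. If $p>(8\cdot6\cdot6)^{-1/3}$, then the set $\mathrm{proj}_{(1,1,1)}(\mathcal M_p)\subset\mathbb R$ has positive one-dimensional Lebesgue measure almost surely conditioned on non-extinction.
   Context: Projection: $\mathrm{proj}_{(1,1,1)}(x,y,z)=x+y+z$. Random Menger sponge: let $T$ be the set of the $20$ vectors obtained from $\{0,\frac13,\frac23\}^3$ by removing the $7$ vectors having at least two coordinates equal to $\frac13$. Let $f_t(x)=\frac13x+t$ on $\mathbb R^3$ for $t\in T$, and $f_{t_1\dots t_n}=f_{t_1}\circ\dots\circ f_{t_n}$. Give each nonempty finite word over $T$ an independent Bernoulli($p$) label, and let $\mathcal E_n\subset T^n$ be the random set of words $t_1\dots t_n$ such that all of $t_1,\ t_1t_2,\dots,\ t_1\dots t_n$ have label $1$. Then $\mathcal M_p:=\bigcap_{n\ge1}\bigcup_{\mathbf t\in\mathcal E_n}f_{\mathbf t}([0,1]^3)$. Non-extinction is the event that $\mathcal E_n\neq\emptyset$ for all $n$; a property holds "almost surely conditioned on non-extinction" if the event that non-extinction occurs and the property fails has probability $0$. *)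

theory Defs
  imports "HOL-Probability.Probability"
begin

definition proj111 :: "real^3 \<Rightarrow> real" where
  "proj111 v = v $ 1 + v $ 2 + v $ 3"

definition menger_T :: "(real^3) set" where
  "menger_T = {t. \<forall>i. t $ i \<in> {0, 1/3, 2/3}} - {t. card {i. t $ i = 1/3} \<ge> 2}"

definition menger_map :: "real^3 \<Rightarrow> real^3 \<Rightarrow> real^3" where
  "menger_map t x = (1/3) *\<^sub>R x + t"

definition word_map :: "(real^3) list \<Rightarrow> real^3 \<Rightarrow> real^3" where
  "word_map w = foldr (\<lambda>t g. menger_map t \<circ> g) w id"

definition menger_words :: "nat \<Rightarrow> (real^3) list set" where
  "menger_words n = {w. length w = n \<and> set w \<subseteq> menger_T}"

text \<open>\<open>X w \<omega>\<close> says that the word \<open>w\<close> has label 1 under the outcome \<open>\<omega>\<close>.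
  Only the labels of nonempty words over \<^const>\<open>menger_T\<close> are constrained.\<close>

definition bernoulli_labels ::
    "'w measure \<Rightarrow> real \<Rightarrow> ((real^3) list \<Rightarrow> 'w \<Rightarrow> bool) \<Rightarrow> bool" where
  "bernoulli_labels M p X \<longleftrightarrow>
     prob_space.indep_vars M (\<lambda>_. count_space UNIV) X (\<Union>n\<in>{1..}. menger_words n) \<and>
     (\<forall>w\<in>(\<Union>n\<in>{1..}. menger_words n).
        distr M (count_space UNIV) (X w) = measure_pmf (bernoulli_pmf p))"

definition surviving :: "((real^3) list \<Rightarrow> 'w \<Rightarrow> bool) \<Rightarrow> nat \<Rightarrow> 'w \<Rightarrow> (real^3) list set" where
  "surviving X n \<omega> = {w \<in> menger_words n. \<forall>k\<in>{1..n}. X (take k w) \<omega>}"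

definition random_menger :: "((real^3) list \<Rightarrow> 'w \<Rightarrow> bool) \<Rightarrow> 'w \<Rightarrow> (real^3) set" where
  "random_menger X \<omega> = (\<Inter>n\<in>{1..}. \<Union>w\<in>surviving X n \<omega>. word_map w ` cbox 0 1)"

definition non_extinct :: "((real^3) list \<Rightarrow> 'w \<Rightarrow> bool) \<Rightarrow> 'w \<Rightarrow> bool" where
  "non_extinct X \<omega> \<longleftrightarrow> (\<forall>n. surviving X n \<omega> \<noteq> {})"

text \<open>Membership in \<^const>\<open>null_sets\<close> includes measurability of the exceptional event; merely
  asking that its measure be 0 would hold trivially for a nonmeasurable set.\<close>

definition as_given_non_extinction ::
    "'w measure \<Rightarrow> ((real^3) list \<Rightarrow> 'w \<Rightarrow> bool) \<Rightarrow> ('w \<Rightarrow> bool) \<Rightarrow> bool" where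
  "as_given_non_extinction M X P \<longleftrightarrow> {\<omega> \<in> space M. non_extinct X \<omega> \<and> \<not> P \<omega>} \<in> null_sets M"

end

theory Submission imports Defs begin

text \<open>
  Cut $[0,3]$ at level \<open>n\<close> into triadic cells, indexed by \<open>k \<cdot> 3\<^sup>n + u\<close> with \<open>k < 3\<close> and \<open>u < 3\<^sup>n\<close>, and let
  \<open>s n k u\<close> be the probability that the cell is covered by the projection of a surviving cube. Adding
  a leading digit \<open>d\<close> to \<open>u\<close> multiplies expected numbers of covering cubes by \<open>p\<close> times one of three
  \<open>3 \<times> 3\<close> matrices with column sums \<open>8, 6, 6\<close>, and independence of the subtrees gives
  \<open>s \<ge> a / (1 + a)\<close> for the resulting linear prediction \<open>a\<close>. Hence \<open>1 / (v \<bullet> s)\<close> grows along the digits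
  at most by adding terms \<open>1 / v\<^sub>1\<close>. By Jensen's inequality a weighted mean of the logarithms of the
  entries of \<open>v\<close> has drift at least \<open>ln (8 \<cdot> 6 \<cdot> 6) / 3\<close> under a uniformly random digit, and its increments
  are bounded, so for \<open>p\<^sup>3 \<cdot> 288 > 1\<close> a small negative moment of \<open>v \<bullet> s\<close>, averaged over \<open>u\<close>, is bounded
  uniformly in \<open>n\<close>. The expected length of the level-\<open>n\<close> projections therefore stays away from 0, and
  the limit has positive length with positive probability. Finally, the probability of having length 0
  and the probability of extinction are both fixed points below 1 of the offspring generating function,
  so they coincide.\<close>

section \<open>Negative moments along random digits\<close>

text \<open>Jensen's inequality for the concave logarithm, obtained from its tangent line at the
  weighted mean \<open>m\<close>. The weights are not normalised and single weights may be 0, so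
  column sums 8 and 6 are treated alike.\<close>

lemma weighted_ln_le:
  fixes a b c x y z :: real
  assumes "0 \<le> a" "0 \<le> b" "0 \<le> c" "0 < x" "0 < y" "0 < z" "0 < a + b + c"
  shows "a * ln x + b * ln y + c * ln z
           \<le> (a + b + c) * (ln (a * x + b * y + c * z) - ln (a + b + c))"
proof -
  define m where "m = (a * x + b * y + c * z) / (a + b + c)"
  have "0 < a * x + b * y + c * z"
    using assms by (smt (verit) mult_nonneg_nonneg mult_pos_pos)
  then have m: "0 < m" and lnm: "ln m = ln (a * x + b * y + c * z) - ln (a + b + c)"
    using assms by (auto simp: m_def ln_div)
  have tangent: "ln t \<le> t / m - 1 + ln m" if "0 < t" for t
    using ln_le_minus_one[of "t / m"] that m by (simp add: ln_div)
  have "a * ln x + b * ln y + c * ln z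
          \<le> a * (x / m - 1 + ln m) + b * (y / m - 1 + ln m) + c * (z / m - 1 + ln m)"
    by (intro add_mono mult_left_mono tangent assms)
  also have "\<dots> = (a * x + b * y + c * z) / m + (a + b + c) * (ln m - 1)"
    using m by (simp add: field_simps)
  also have "(a * x + b * y + c * z) / m = a + b + c"
    using assms \<open>0 < a * x + b * y + c * z\<close> by (simp add: m_def)
  finally show ?thesis
    by (simp add: lnm algebra_simps)
qed

text \<open>
  A row vector \<open>(x, y, z)\<close> is multiplied by the transfer matrices, giving the three vectors in
  \<open>balanced_step\<close>. The weights \<open>(5, 14, 5) / 24\<close> are stationary for the average of the three matrices
  after normalising their columns, which makes the terms of \<open>potential x y z\<close> cancel exactly in the
  drift estimate.\<close>

definition potential :: "real \<Rightarrow> real \<Rightarrow> real \<Rightarrow> real" where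
  "potential x y z = (5 * ln x + 14 * ln y + 5 * ln z) / 24"

text \<open>A cone that all three transfer matrices map into itself. On it \<open>y\<close> controls
  the other entries up to constant factors, which keeps the increments of the potential
  bounded.\<close>

definition balanced :: "real \<Rightarrow> real \<Rightarrow> real \<Rightarrow> bool" where
  "balanced x y z \<longleftrightarrow> 0 < y \<and> y / 4 \<le> x \<and> x \<le> 3 * y \<and> y / 4 \<le> z \<and> z \<le> 3 * y"

lemma balanced_step:
  assumes "balanced x y z"
  shows "balanced (x + 6 * y + z) (3 * y + 3 * z) (3 * y + 3 * z)"
    and "balanced (3 * x + 3 * y) (x + 6 * y + z) (3 * y + 3 * z)"
    and "balanced (3 * x + 3 * y) (3 * x + 3 * y) (x + 6 * y + z)"
  using assms by (auto simp: balanced_def)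

text \<open>With the weights 5, 14, 5 the right-hand side collapses to the plain sum of the
  logarithms of \<open>x + 6 * y + z\<close>, \<open>3 * x + 3 * y\<close> and
  \<open>3 * y + 3 * z\<close>. Jensen's inequality for each yields the constants
  \<open>ln 8\<close>, \<open>ln 6\<close>, \<open>ln 6\<close> and the coefficients 5/8, 14/8, 5/8,
  which are three times the weights.\<close>

lemma potential_drift:
  assumes "0 < x" "0 < y" "0 < z"
  shows "3 * potential x y z + ln 288
    \<le> potential (x + 6 * y + z) (3 * y + 3 * z) (3 * y + 3 * z)
     + potential (3 * x + 3 * y) (x + 6 * y + z) (3 * y + 3 * z)
     + potential (3 * x + 3 * y) (3 * x + 3 * y) (x + 6 * y + z)"
proof -
  have "(288::real) = 8 * (6 * 6)" by simp
  then have l: "ln (288::real) = ln 8 + (ln 6 + ln 6)"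
    by (simp only: ln_mult_pos)
  have "ln x + 6 * ln y + ln z \<le> 8 * (ln (x + 6 * y + z) - ln 8)"
    using weighted_ln_le[of 1 6 1 x y z] assms by simp
  moreover have "3 * ln x + 3 * ln y \<le> 6 * (ln (3 * x + 3 * y) - ln 6)"
    using weighted_ln_le[of 3 3 0 x y z] assms by simp
  moreover have "3 * ln y + 3 * ln z \<le> 6 * (ln (3 * y + 3 * z) - ln 6)"
    using weighted_ln_le[of 0 3 3 x y z] assms by simp
  ultimately show ?thesis
    unfolding potential_def l by argo
qed

lemma potential_bounds:
  assumes "0 < l" "l \<le> x" "x \<le> u" "l \<le> y" "y \<le> u" "l \<le> z" "z \<le> u"
  shows "ln l \<le> potential x y z" "potential x y z \<le> ln u"
proof -
  have "ln l \<le> ln x" "ln l \<le> ln y" "ln l \<le> ln z" "ln x \<le> ln u" "ln y \<le> ln u" "ln z \<le> ln u"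
    using assms by simp_all
  then show "ln l \<le> potential x y z" "potential x y z \<le> ln u"
    by (simp_all add: potential_def)
qed

text \<open>All entries of the old vector lie in \<open>[y / 4, 3 * y]\<close> and all entries of
  the new one in \<open>[3 * y, 12 * y]\<close>; 48 is the ratio of \<open>12 * y\<close> to
  \<open>y / 4\<close>.\<close>

lemma potential_increment:
  assumes v: "balanced x y z" and l: "3 * y \<le> x'" "3 * y \<le> y'" "3 * y \<le> z'"
    and u: "x' \<le> 12 * y" "y' \<le> 12 * y" "z' \<le> 12 * y"
  shows "0 \<le> potential x' y' z' - potential x y z" "potential x' y' z' - potential x y z \<le> ln 48"
proof -
  have y: "0 < y" using v by (simp add: balanced_def)
  have "ln (3 * y) \<le> potential x' y' z'" "potential x' y' z' \<le> ln (12 * y)"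
    using potential_bounds[of "3 * y" x' "12 * y" y' z'] y l u by simp_all
  moreover have "ln (y / 4) \<le> potential x y z" "potential x y z \<le> ln (3 * y)"
    using potential_bounds[of "y / 4" x "3 * y" y z] v by (simp_all add: balanced_def)
  moreover have "ln (12 * y) - ln (y / 4) = ln 48"
    using y ln_div[of "12 * y" "y / 4"] by simp
  ultimately show "0 \<le> potential x' y' z' - potential x y z"
    and "potential x' y' z' - potential x y z \<le> ln 48"
    by simp_all
qed

text \<open>Follows from \<open>(1 + x) * (1 - x + x\<^sup>2) = 1 + x ^ 3\<close> together with
  \<open>1 + x \<le> exp x\<close>.\<close>

lemma exp_minus_le_quadratic:
  fixes x :: real
  assumes "0 \<le> x"
  shows "exp (- x) \<le> 1 - x + x\<^sup>2"
proof -
  have pos: "0 \<le> 1 - x + x\<^sup>2"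
    using zero_le_power2[of "x - 1 / 2"] by (simp add: power2_eq_square algebra_simps)
  have "1 \<le> (1 + x) * (1 - x + x\<^sup>2)"
    using assms by (simp add: algebra_simps power2_eq_square)
  also have "\<dots> \<le> exp x * (1 - x + x\<^sup>2)"
    by (intro mult_right_mono exp_ge_add_one_self pos)
  finally show ?thesis
    by (simp add: exp_minus field_simps)
qed

text \<open>Each exponential is expanded to second order in the increment of the potential. The
  three linear terms add up to the drift, and the bound \<open>ln 48\<close> on increments controls
  the quadratic terms.\<close>

lemma exp_potential_contraction:
  fixes \<theta> :: real
  assumes v: "balanced x y z" and "0 < \<theta>"
  shows "exp (- \<theta> * potential (x + 6 * y + z) (3 * y + 3 * z) (3 * y + 3 * z))
     + exp (- \<theta> * potential (3 * x + 3 * y) (x + 6 * y + z) (3 * y + 3 * z))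
     + exp (- \<theta> * potential (3 * x + 3 * y) (3 * x + 3 * y) (x + 6 * y + z))
     \<le> 3 * (1 - \<theta> * (ln 288 / 3) + (\<theta> * ln 48)\<^sup>2) * exp (- \<theta> * potential x y z)"
proof -
  let ?P = "potential x y z"
  let ?A = "potential (x + 6 * y + z) (3 * y + 3 * z) (3 * y + 3 * z)"
  let ?B = "potential (3 * x + 3 * y) (x + 6 * y + z) (3 * y + 3 * z)"
  let ?C = "potential (3 * x + 3 * y) (3 * x + 3 * y) (x + 6 * y + z)"
  have one: "exp (- \<theta> * Q) \<le> (1 - \<theta> * (Q - ?P) + (\<theta> * ln 48)\<^sup>2) * exp (- \<theta> * ?P)"
    if "0 \<le> Q - ?P" "Q - ?P \<le> ln 48" for Q
  proof -
    have "exp (- \<theta> * Q) = exp (- (\<theta> * (Q - ?P))) * exp (- \<theta> * ?P)"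
      by (simp flip: exp_add add: algebra_simps)
    also have "\<dots> \<le> (1 - \<theta> * (Q - ?P) + (\<theta> * (Q - ?P))\<^sup>2) * exp (- \<theta> * ?P)"
      using that \<open>0 < \<theta>\<close> by (intro mult_right_mono exp_minus_le_quadratic) auto
    also have "\<dots> \<le> (1 - \<theta> * (Q - ?P) + (\<theta> * ln 48)\<^sup>2) * exp (- \<theta> * ?P)"
      using that \<open>0 < \<theta>\<close> by (intro mult_right_mono add_left_mono power_mono mult_left_mono) auto
    finally show ?thesis .
  qed
  have y: "0 < x" "0 < y" "0 < z" "y / 4 \<le> x" "x \<le> 3 * y" "y / 4 \<le> z" "z \<le> 3 * y"
    using v by (auto simp: balanced_def)
  have "exp (- \<theta> * ?A) + exp (- \<theta> * ?B) + exp (- \<theta> * ?C)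
     \<le> (1 - \<theta> * (?A - ?P) + (\<theta> * ln 48)\<^sup>2) * exp (- \<theta> * ?P)
     + (1 - \<theta> * (?B - ?P) + (\<theta> * ln 48)\<^sup>2) * exp (- \<theta> * ?P)
     + (1 - \<theta> * (?C - ?P) + (\<theta> * ln 48)\<^sup>2) * exp (- \<theta> * ?P)"
    by (intro add_mono one potential_increment[OF v]) (use y in simp_all)
  also have "\<dots> = (3 * (1 + (\<theta> * ln 48)\<^sup>2) - \<theta> * (?A + ?B + ?C - 3 * ?P)) * exp (- \<theta> * ?P)"
    by (simp add: algebra_simps)
  also have "\<dots> \<le> (3 * (1 + (\<theta> * ln 48)\<^sup>2) - \<theta> * ln 288) * exp (- \<theta> * ?P)"
    using potential_drift[of x y z] y \<open>0 < \<theta>\<close>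
    by (intro mult_right_mono diff_left_mono mult_left_mono) auto
  finally show ?thesis
    by (simp add: algebra_simps)
qed

lemma exists_contraction_exponent:
  fixes p :: real
  assumes "0 < p" "p > 288 powr (- (1/3))"
  obtains \<theta> :: real where "0 < \<theta>" "\<theta> \<le> 1"
    "1 - \<theta> * (ln 288 / 3) + (\<theta> * ln 48)\<^sup>2 < p powr \<theta>"
proof -
  \<comment> \<open>The excess of the drift over the loss \<open>- ln p\<close> caused by deleting
    cubes; the hypothesis on \<open>p\<close> says exactly that it is positive.\<close>
  define \<eta> where "\<eta> = ln p + ln 288 / 3"
  have "ln (288 powr (- (1/3))) < ln p"
    using assms by (subst ln_less_cancel_iff) auto
  then have \<eta>: "0 < \<eta>"
    by (simp add: \<eta>_def ln_powr)
  \<comment> \<open>Small enough for the linear gain \<open>\<theta> * \<eta>\<close> to beat the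
    quadratic error, with a factor 2 for strictness; the cap 1 is needed for subadditivity of
    \<open>powr\<close>.\<close>
  define \<theta> where "\<theta> = min 1 (\<eta> / (2 * (ln 48)\<^sup>2))"
  have b: "0 < (ln (48::real))\<^sup>2" by simp
  have \<theta>: "0 < \<theta>" "\<theta> \<le> 1" using \<eta> b by (auto simp: \<theta>_def)
  have "\<theta> * (ln 48)\<^sup>2 \<le> \<eta> / (2 * (ln 48)\<^sup>2) * (ln 48)\<^sup>2"
    using b by (intro mult_right_mono) (auto simp: \<theta>_def)
  also have "\<dots> < \<eta>" using \<eta> b by simp
  finally have "\<theta> * (\<theta> * (ln 48)\<^sup>2) < \<theta> * \<eta>"
    using \<theta> by (intro mult_strict_left_mono)
  then have "1 - \<theta> * (ln 288 / 3) + (\<theta> * ln 48)\<^sup>2 < 1 + \<theta> * ln p"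
    by (simp add: \<eta>_def algebra_simps power2_eq_square)
  also have "\<dots> \<le> p powr \<theta>"
    using exp_ge_add_one_self[of "\<theta> * ln p"] assms by (simp add: powr_def)
  finally show thesis using that \<theta> by blast
qed

section \<open>Recursion for the negative moments\<close>

lemma powr_add_le:
  fixes a b \<theta> :: real
  assumes "0 < a" "0 < b" "0 < \<theta>" "\<theta> \<le> 1"
  shows "(a + b) powr \<theta> \<le> a powr \<theta> + b powr \<theta>"
proof -
  have frac: "t \<le> t powr \<theta>" if "0 < t" "t \<le> 1" for t :: real
    using powr_mono'[of \<theta> 1 t] that assms by simp
  have "1 = a / (a + b) + b / (a + b)"
    using assms by (simp flip: add_divide_distrib)
  also have "\<dots> \<le> (a / (a + b)) powr \<theta> + (b / (a + b)) powr \<theta>"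
    using assms by (intro add_mono frac) auto
  also have "\<dots> = (a powr \<theta> + b powr \<theta>) / (a + b) powr \<theta>"
    using assms by (simp add: powr_divide add_divide_distrib)
  finally show ?thesis
    using assms by (simp add: field_simps)
qed

text \<open>
  \<open>digit_count j\<close> is the number of vectors in \<^const>\<open>menger_T\<close> with coordinate sum \<open>j / 3\<close>.\<close>

definition digit_count :: "int \<Rightarrow> real" where
  "digit_count j = (if j = 0 \<or> j = 6 then 1 else if j = 3 then 6
     else if j \<in> {1, 2, 4, 5} then 3 else 0)"

text \<open>With the common denominator \<open>1 + a1\<close>, the reciprocal of
  \<open>x * s0 + y * s1 + z * s2\<close> is at most \<open>(1 + a1) / w\<close>, where
  \<open>w\<close> is the linear prediction. Since \<open>y * a1 \<le> w\<close>, this is at most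
  \<open>1 / y + 1 / w\<close>, and subadditivity separates the two terms.\<close>

lemma powr_combination_le:
  fixes x y z a0 a1 a2 s0 s1 s2 \<theta> :: real
  assumes "0 < x" "0 < y" "0 < z" and a: "0 \<le> a0" "0 < a1" "0 \<le> a2" "a0 \<le> a1" "a2 \<le> a1"
    and s: "a0 / (1 + a1) \<le> s0" "a1 / (1 + a1) \<le> s1" "a2 / (1 + a1) \<le> s2"
    and \<theta>: "0 < \<theta>" "\<theta> \<le> 1"
  shows "(x * s0 + y * s1 + z * s2) powr (- \<theta>)
    \<le> y powr (- \<theta>) + (x * a0 + y * a1 + z * a2) powr (- \<theta>)"
proof -
  define w where "w = x * a0 + y * a1 + z * a2"
  have yw: "y * a1 \<le> w" using assms by (simp add: w_def)
  moreover have "0 < y * a1" using assms by simp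
  ultimately have w: "0 < w" by linarith
  have "w / (1 + a1) = x * (a0 / (1 + a1)) + y * (a1 / (1 + a1)) + z * (a2 / (1 + a1))"
    by (simp add: w_def add_divide_distrib)
  also have "\<dots> \<le> x * s0 + y * s1 + z * s2"
    using assms by (intro add_mono mult_left_mono) auto
  finally have le: "w / (1 + a1) \<le> x * s0 + y * s1 + z * s2" .
  have "(x * s0 + y * s1 + z * s2) powr (- \<theta>) \<le> (w / (1 + a1)) powr (- \<theta>)"
    using le w a \<theta> by (intro powr_mono2') auto
  also have "\<dots> = ((1 + a1) / w) powr \<theta>"
    using w a by (simp add: powr_minus powr_divide)
  also have "\<dots> \<le> (1 / y + 1 / w) powr \<theta>"
  proof (rule powr_mono2)
    have "a1 / w \<le> 1 / y"
      using yw w assms(2) by (simp add: field_simps)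
    then show "(1 + a1) / w \<le> 1 / y + 1 / w"
      by (simp add: add_divide_distrib)
  qed (use w a \<theta> in auto)
  also have "\<dots> \<le> (1 / y) powr \<theta> + (1 / w) powr \<theta>"
    using w assms by (intro powr_add_le) auto
  also have "\<dots> = y powr (- \<theta>) + w powr (- \<theta>)"
    using w assms by (simp add: powr_minus powr_divide inverse_eq_divide)
  finally show ?thesis by (simp add: w_def)
qed


lemma sum_lessThan_3: "(\<Sum>k<(3::nat). f k) = f 0 + f 1 + f 2"
  by (simp add: eval_nat_numeral)

lemma sum_triadic:
  fixes f :: "nat \<Rightarrow> 'b::comm_monoid_add"
  shows "(\<Sum>u<3 ^ Suc n. f u) = (\<Sum>d<3. \<Sum>u<3 ^ n. f (d * 3 ^ n + u))"
proof -
  have "(\<Sum>u<3 ^ Suc n. f u) = (\<Sum>d<3. sum f {d * 3 ^ n..<d * 3 ^ n + 3 ^ n})"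
    using sum.nat_group[of f "3 ^ n" 3] by simp
  also have "\<dots> = (\<Sum>d<3. \<Sum>u<3 ^ n. f (d * 3 ^ n + u))"
    using sum.shift_bounds_nat_ivl[of f 0 "_ * 3 ^ n" "3 ^ n"]
    by (simp add: lessThan_atLeast0 add.commute)
  finally show ?thesis .
qed

text \<open>Separates the deterministic analysis from the probability: only the recursive lower
  bound \<open>a / (1 + a)\<close> on the survival probabilities is retained.\<close>

locale triadic_survival =
  fixes s :: "nat \<Rightarrow> nat \<Rightarrow> nat \<Rightarrow> real" and p :: real
  assumes p: "0 < p" "p > 288 powr (- (1/3))"
    and base: "k < 3 \<Longrightarrow> s 0 k 0 = 1"
    and nonneg: "0 \<le> s n k u"
    and step: "\<lbrakk>k < 3; d < 3; u < 3 ^ n\<rbrakk> \<Longrightarrow>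
      (p * (\<Sum>i<3. digit_count (3 * int k + int d - int i) * s n i u))
       / (1 + p * (\<Sum>i<3. digit_count (3 * int k + int d - int i) * s n i u)) \<le> s (Suc n) k (d * 3 ^ n + u)"
begin

lemma middle_pos: "u < 3 ^ n \<Longrightarrow> 0 < s n 1 u"
proof (induction n arbitrary: u)
  case 0
  then show ?case using base[of 1] by simp
next
  case (Suc n)
  define d v where "d = u div 3 ^ n" and "v = u mod 3 ^ n"
  have d: "d < 3" and v: "v < 3 ^ n"
    using Suc.prems by (simp_all add: d_def v_def less_mult_imp_div_less)
  have u: "u = d * 3 ^ n + v"
    unfolding d_def v_def by (rule div_mult_mod_eq[symmetric])
  let ?a = "p * (\<Sum>i<3. digit_count (3 + int d - int i) * s n i v)"
  \<comment> \<open>For every digit the middle cell is fed by the middle cell one level down with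
    multiplicity 3 or 6, so positivity propagates.\<close>
  have "0 < digit_count (3 + int d - int 1) * s n 1 v"
    using Suc.IH[OF v] d by (auto simp: digit_count_def)
  also have "\<dots> \<le> (\<Sum>i<3. digit_count (3 + int d - int i) * s n i v)"
    using nonneg by (intro member_le_sum) (auto simp: digit_count_def)
  finally have "0 < ?a" using p by simp
  then have "0 < ?a / (1 + ?a)" by simp
  also have "\<dots> \<le> s (Suc n) 1 u"
    using step[of 1 d v n] d v u by simp
  finally show ?case .
qed

definition inv_moment :: "real \<Rightarrow> nat \<Rightarrow> real \<Rightarrow> real \<Rightarrow> real \<Rightarrow> real" where
  "inv_moment \<theta> n x y z = (\<Sum>u<3 ^ n. (x * s n 0 u + y * s n 1 u + z * s n 2 u) powr (- \<theta>))"

text \<open>Splitting off the leading digit \<open>d\<close> of \<open>u\<close> moves the transfer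
  matrix of \<open>d\<close> from the survival probabilities to the row vector. The saturation
  \<open>a / (1 + a)\<close> costs only the additive term in \<open>y\<close>, once for each of the
  \<open>3 ^ Suc n\<close> cells.\<close>

lemma inv_moment_Suc:
  assumes v: "0 < x" "0 < y" "0 < z" and \<theta>: "0 < \<theta>" "\<theta> \<le> 1"
  shows "inv_moment \<theta> (Suc n) x y z \<le> 3 ^ Suc n * y powr (- \<theta>) + p powr (- \<theta>) *
    (inv_moment \<theta> n (x + 6 * y + z) (3 * y + 3 * z) (3 * y + 3 * z)
     + inv_moment \<theta> n (3 * x + 3 * y) (x + 6 * y + z) (3 * y + 3 * z)
     + inv_moment \<theta> n (3 * x + 3 * y) (3 * x + 3 * y) (x + 6 * y + z))"
proof -
  \<comment> \<open>\<open>A d\<close> is the transfer matrix of the digit \<open>d\<close>, and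
    \<open>B d\<close> below is the row vector \<open>(x, y, z)\<close> multiplied by it.\<close>
  define A where "A d k i = digit_count (3 * int k + int d - int i)" for d k i :: nat
  define a where "a d k u = p * (\<Sum>i<3. A d k i * s n i u)" for d k u
  define B where "B d i = x * A d 0 i + y * A d 1 i + z * A d 2 i" for d i
  have A_nonneg: "0 \<le> A d k i" for d k i
    by (simp add: A_def digit_count_def)
  have a_nonneg: "0 \<le> a d k u" for d k u
    using p nonneg A_nonneg by (auto simp: a_def intro!: mult_nonneg_nonneg sum_nonneg)
  \<comment> \<open>The middle row dominates the other two entrywise, so \<open>1 + a d 1 u\<close>
    can serve as the common denominator of all three rows.\<close>
  have A_le: "A d k i \<le> A d 1 i" if "d < 3" "k < 3" "i < 3" for d k i
  proof -
    have "d \<in> {0, 1, 2}" "k \<in> {0, 1, 2}" "i \<in> {0, 1, 2}" using that by auto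
    then show ?thesis by (auto simp: A_def digit_count_def)
  qed
  have a_le: "a d k u \<le> a d 1 u" if "d < 3" "k < 3" for d k u
    unfolding a_def using p nonneg A_le that
    by (intro mult_left_mono sum_mono mult_right_mono) auto
  have a_pos: "0 < a d 1 u" if "d < 3" "u < 3 ^ n" for d u
  proof -
    have "0 < A d 1 1 * s n 1 u"
      using middle_pos that by (auto simp: A_def digit_count_def)
    also have "\<dots> \<le> (\<Sum>i<3. A d 1 i * s n i u)"
      using nonneg A_nonneg by (intro member_le_sum) auto
    finally show ?thesis using p by (simp add: a_def)
  qed
  have s_ge: "a d k u / (1 + a d 1 u) \<le> s (Suc n) k (d * 3 ^ n + u)"
    if "d < 3" "k < 3" "u < 3 ^ n" for d k u
  proof -
    have "a d k u / (1 + a d 1 u) \<le> a d k u / (1 + a d k u)"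
      using a_nonneg a_le that by (intro divide_left_mono) (auto intro!: mult_pos_pos add_pos_nonneg)
    also have "\<dots> \<le> s (Suc n) k (d * 3 ^ n + u)"
      using step[of k d u n] that by (simp add: a_def A_def)
    finally show ?thesis .
  qed
  have one: "(x * s (Suc n) 0 (d * 3 ^ n + u) + y * s (Suc n) 1 (d * 3 ^ n + u)
        + z * s (Suc n) 2 (d * 3 ^ n + u)) powr (- \<theta>)
      \<le> y powr (- \<theta>) + p powr (- \<theta>) * (B d 0 * s n 0 u + B d 1 * s n 1 u + B d 2 * s n 2 u) powr (- \<theta>)"
    if "d < 3" "u < 3 ^ n" for d u
  proof -
    have "x * a d 0 u + y * a d 1 u + z * a d 2 u
        = p * (B d 0 * s n 0 u + B d 1 * s n 1 u + B d 2 * s n 2 u)"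
      by (simp add: a_def B_def sum_lessThan_3 algebra_simps)
    moreover have "0 \<le> B d 0 * s n 0 u + B d 1 * s n 1 u + B d 2 * s n 2 u"
      using v nonneg A_nonneg by (auto simp: B_def intro!: add_nonneg_nonneg mult_nonneg_nonneg)
    ultimately have "(x * a d 0 u + y * a d 1 u + z * a d 2 u) powr (- \<theta>)
        = p powr (- \<theta>) * (B d 0 * s n 0 u + B d 1 * s n 1 u + B d 2 * s n 2 u) powr (- \<theta>)"
      using p by (simp add: powr_mult)
    moreover have "(x * s (Suc n) 0 (d * 3 ^ n + u) + y * s (Suc n) 1 (d * 3 ^ n + u)
        + z * s (Suc n) 2 (d * 3 ^ n + u)) powr (- \<theta>)
      \<le> y powr (- \<theta>) + (x * a d 0 u + y * a d 1 u + z * a d 2 u) powr (- \<theta>)"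
      by (intro powr_combination_le a_nonneg a_pos a_le s_ge v \<theta> that) auto
    ultimately show ?thesis by simp
  qed
  have "inv_moment \<theta> (Suc n) x y z \<le> (\<Sum>d<3. \<Sum>u<3 ^ n. y powr (- \<theta>)
      + p powr (- \<theta>) * (B d 0 * s n 0 u + B d 1 * s n 1 u + B d 2 * s n 2 u) powr (- \<theta>))"
    unfolding inv_moment_def sum_triadic by (intro sum_mono one) auto
  also have "\<dots> = 3 ^ Suc n * y powr (- \<theta>)
      + p powr (- \<theta>) * (\<Sum>d<3. inv_moment \<theta> n (B d 0) (B d 1) (B d 2))"
    by (simp add: inv_moment_def sum.distrib sum_distrib_left)
  also have "(\<Sum>d<3. inv_moment \<theta> n (B d 0) (B d 1) (B d 2)) =
     inv_moment \<theta> n (x + 6 * y + z) (3 * y + 3 * z) (3 * y + 3 * z)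
     + inv_moment \<theta> n (3 * x + 3 * y) (x + 6 * y + z) (3 * y + 3 * z)
     + inv_moment \<theta> n (3 * x + 3 * y) (3 * x + 3 * y) (x + 6 * y + z)"
    by (simp add: sum_lessThan_3 B_def A_def digit_count_def mult.commute)
  finally show ?thesis .
qed

text \<open>Induction on the level: after the three branches are recombined, the normalised constant
  evolves by \<open>K \<mapsto> 3 + \<rho> * K\<close> with \<open>\<rho> < 1\<close>, so a fixed
  point of this map is a uniform bound.\<close>

lemma inv_moment_le:
  obtains \<theta> K where "0 < \<theta>" "0 < K"
    "\<And>n x y z. balanced x y z \<Longrightarrow> inv_moment \<theta> n x y z \<le> 3 ^ n * K * exp (- \<theta> * potential x y z)"
proof -
  obtain \<theta> where \<theta>: "0 < \<theta>" "\<theta> \<le> 1"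
    and contr: "1 - \<theta> * (ln 288 / 3) + (\<theta> * ln 48)\<^sup>2 < p powr \<theta>" (is "?\<kappa> < _")
    using exists_contraction_exponent p by blast
  \<comment> \<open>Taking the maximum with 0 keeps the ratio nonnegative without any sign
    information on \<open>?\<kappa>\<close>.\<close>
  define \<rho> where "\<rho> = p powr (- \<theta>) * max 0 ?\<kappa>"
  have "p powr (- \<theta>) * max 0 ?\<kappa> < p powr (- \<theta>) * p powr \<theta>"
    using contr p by (intro mult_strict_left_mono) auto
  then have \<rho>: "0 \<le> \<rho>" "\<rho> < 1"
    using p by (auto simp: \<rho>_def simp flip: powr_add)
  define K where "K = 3 / (1 - \<rho>)"
  have K: "3 \<le> K" "3 + \<rho> * K = K"
    using \<rho> by (auto simp: K_def field_simps)
  \<comment> \<open>The additive term is absorbed by the potential, which is at most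
    \<open>ln (3 * y)\<close>; the factor 3 bounds \<open>3 powr \<theta>\<close>.\<close>
  have front: "y powr (- \<theta>) \<le> 3 * exp (- \<theta> * potential x y z)" if "balanced x y z" for x y z
  proof -
    have "potential x y z \<le> ln (3 * y)"
      using potential_bounds[of "y / 4" x "3 * y" y z] that by (simp add: balanced_def)
    then have "\<theta> * potential x y z \<le> \<theta> * (ln 3 + ln y)"
      using \<theta> that by (simp add: balanced_def ln_mult)
    moreover have "\<theta> * ln 3 \<le> 1 * ln (3::real)"
      using \<theta> by (intro mult_right_mono) auto
    ultimately have "- \<theta> * ln y \<le> ln 3 + - \<theta> * potential x y z"
      by (simp only: distrib_left)
    then have "exp (- \<theta> * ln y) \<le> exp (ln 3 + - \<theta> * potential x y z)"
      by simp
    then show ?thesis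
      using that by (simp only: exp_add) (simp add: powr_def balanced_def)
  qed
  have "inv_moment \<theta> n x y z \<le> 3 ^ n * K * exp (- \<theta> * potential x y z)"
    if "balanced x y z" for n x y z
    using that
  proof (induction n arbitrary: x y z)
    case 0
    then have y: "0 < x" "0 < y" "0 < z" by (auto simp: balanced_def)
    have "inv_moment \<theta> 0 x y z = (x + y + z) powr (- \<theta>)"
      by (simp add: inv_moment_def base)
    also have "\<dots> \<le> y powr (- \<theta>)"
      using y \<theta> by (intro powr_mono2') auto
    also have "\<dots> \<le> 3 * exp (- \<theta> * potential x y z)"
      by (rule front) fact
    also have "\<dots> \<le> K * exp (- \<theta> * potential x y z)"
      using K by simp
    finally show ?case by simp
  next
    case (Suc n)
    let ?E = "\<lambda>x y z. exp (- \<theta> * potential x y z)"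
    note bal = balanced_step[OF Suc.prems]
    have y: "0 < x" "0 < y" "0 < z" using Suc.prems by (auto simp: balanced_def)
    have "inv_moment \<theta> (Suc n) x y z \<le> 3 ^ Suc n * y powr (- \<theta>) + p powr (- \<theta>) *
      (3 ^ n * K * ?E (x + 6 * y + z) (3 * y + 3 * z) (3 * y + 3 * z)
     + 3 ^ n * K * ?E (3 * x + 3 * y) (x + 6 * y + z) (3 * y + 3 * z)
     + 3 ^ n * K * ?E (3 * x + 3 * y) (3 * x + 3 * y) (x + 6 * y + z))"
      by (intro order.trans[OF inv_moment_Suc[OF y \<theta>]] add_left_mono mult_left_mono add_mono
            Suc.IH bal) auto
    also have "\<dots> = 3 ^ Suc n * y powr (- \<theta>) + p powr (- \<theta>) * (3 ^ n * K *
      (?E (x + 6 * y + z) (3 * y + 3 * z) (3 * y + 3 * z)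
     + ?E (3 * x + 3 * y) (x + 6 * y + z) (3 * y + 3 * z)
     + ?E (3 * x + 3 * y) (3 * x + 3 * y) (x + 6 * y + z)))"
      by (simp only: distrib_left)
    also have "\<dots> \<le> 3 ^ Suc n * (3 * ?E x y z) + p powr (- \<theta>) * (3 ^ n * K * (3 * ?\<kappa> * ?E x y z))"
      using K by (intro add_mono mult_left_mono front Suc.prems exp_potential_contraction \<theta>) auto
    also have "\<dots> \<le> 3 ^ Suc n * (3 * ?E x y z) + p powr (- \<theta>) * (3 ^ n * K * (3 * max 0 ?\<kappa> * ?E x y z))"
      using K by (intro add_mono mult_left_mono mult_right_mono order.refl) auto
    also have "\<dots> = 3 ^ Suc n * (3 + \<rho> * K) * ?E x y z"
      by (simp add: \<rho>_def algebra_simps)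
    finally show ?case by (simp only: K)
  qed
  then show thesis
    using that[of \<theta> K] \<theta> K by simp
qed

text \<open>By Markov's inequality a negative moment bound keeps the average itself away from 0.\<close>

lemma survival_average:
  obtains c where "0 < c" "\<And>n. c * 3 ^ n \<le> (\<Sum>u<3 ^ n. s n 0 u + s n 1 u + s n 2 u)"
proof -
  obtain \<theta> K where \<theta>: "0 < \<theta>" "0 < K"
    and le: "\<And>n x y z. balanced x y z \<Longrightarrow> inv_moment \<theta> n x y z \<le> 3 ^ n * K * exp (- \<theta> * potential x y z)"
    using inv_moment_le by blast
  \<comment> \<open>Chosen so that \<open>\<delta> powr (- \<theta>) = 2 * K\<close>, twice the
    bound on the mean of the negative moment.\<close>
  define \<delta> where "\<delta> = (2 * K) powr (- (1 / \<theta>))"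
  have \<delta>: "0 < \<delta>" using \<theta> by (simp add: \<delta>_def)
  have \<delta>_powr: "\<delta> powr (- \<theta>) = 2 * K"
    using \<theta> by (simp add: \<delta>_def powr_powr)
  \<comment> \<open>A pointwise form of Markov's inequality: below \<open>\<delta>\<close> the
    left-hand side is not positive, and otherwise it is at most \<open>\<delta>\<close>.\<close>
  have markov: "\<delta> * (1 - t powr (- \<theta>) / (2 * K)) \<le> t" if "0 < t" for t
  proof (cases "t < \<delta>")
    case True
    then have "2 * K \<le> t powr (- \<theta>)"
      using that \<theta> \<delta>_powr powr_mono2'[of "- \<theta>" t \<delta>] by simp
    then have "1 - t powr (- \<theta>) / (2 * K) \<le> 0"
      using \<theta> by simp
    then show ?thesis
      using \<delta> that by (smt (verit) mult_nonneg_nonpos)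
  next
    case False
    have "\<delta> * (1 - t powr (- \<theta>) / (2 * K)) \<le> \<delta> * 1"
      using \<delta> \<theta> by (intro mult_left_mono) auto
    with False show ?thesis by simp
  qed
  have "(\<delta> / 2) * 3 ^ n \<le> (\<Sum>u<3 ^ n. s n 0 u + s n 1 u + s n 2 u)" for n
  proof -
    define t where "t u = s n 0 u + s n 1 u + s n 2 u" for u
    have t: "0 < t u" if "u < 3 ^ n" for u
      using middle_pos[OF that] nonneg[of n 0 u] nonneg[of n 2 u] by (simp add: t_def)
    \<comment> \<open>The vector \<open>(1, 1, 1)\<close> is balanced and has potential 0.\<close>
    have m: "(\<Sum>u<3 ^ n. t u powr (- \<theta>)) \<le> 3 ^ n * K"
      using le[of 1 1 1 n] by (simp add: inv_moment_def t_def balanced_def potential_def)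
    have "(\<delta> / 2) * 3 ^ n = \<delta> * (3 ^ n - (3 ^ n * K) / (2 * K))"
      using \<theta> by (simp add: algebra_simps)
    also have "\<dots> \<le> \<delta> * (3 ^ n - (\<Sum>u<3 ^ n. t u powr (- \<theta>)) / (2 * K))"
      using m \<theta> \<delta> by (intro mult_left_mono diff_left_mono divide_right_mono) auto
    also have "\<dots> = (\<Sum>u<3 ^ n. \<delta> * (1 - t u powr (- \<theta>) / (2 * K)))"
      by (simp add: sum_subtractf sum_divide_distrib flip: sum_distrib_left)
    also have "\<dots> \<le> (\<Sum>u<3 ^ n. t u)"
      by (intro sum_mono markov t) auto
    finally show ?thesis by (simp add: t_def)
  qed
  then show thesis
    using that[of "\<delta> / 2"] \<delta> by simp
qed

end

section \<open>Projections of surviving cubes\<close>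

definition vec3 :: "nat \<times> nat \<times> nat \<Rightarrow> real^3" where
  "vec3 = (\<lambda>(a, b, c). vector [real a / 3, real b / 3, real c / 3])"

text \<open>The 20 triples are listed explicitly so that sums over the digit set can be evaluated by
  simplification.\<close>

definition menger_digits :: "(nat \<times> nat \<times> nat) set" where
  "menger_digits = {(0,0,0), (0,0,1), (0,0,2), (0,1,0), (0,1,2), (0,2,0), (0,2,1), (0,2,2),
     (1,0,0), (1,0,2), (1,2,0), (1,2,2),
     (2,0,0), (2,0,1), (2,0,2), (2,1,0), (2,1,2), (2,2,0), (2,2,1), (2,2,2)}"

lemma card_coords_ge_2:
  fixes P :: "3 \<Rightarrow> bool"
  shows "2 \<le> card {i. P i} \<longleftrightarrow> P 1 \<and> P 2 \<or> P 1 \<and> P 3 \<or> P 2 \<and> P 3"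
proof -
  have "card {i. P i} = (\<Sum>i\<in>UNIV. if P i then 1 else 0)"
    by (simp add: sum.If_cases)
  then show ?thesis by (simp add: sum_3)
qed

lemma vec3_eq_iff:
  "v = vec3 (a, b, c) \<longleftrightarrow> v $ 1 = a / 3 \<and> v $ 2 = b / 3 \<and> v $ 3 = c / 3"
  by (simp add: vec3_def vec_eq_iff forall_3 vector_3)

lemma menger_T_eq: "menger_T = vec3 ` menger_digits"
proof (intro set_eqI iffI)
  fix v assume "v \<in> menger_T"
  then have v: "v $ 1 \<in> {0, 1/3, 2/3}" "v $ 2 \<in> {0, 1/3, 2/3}" "v $ 3 \<in> {0, 1/3, 2/3}"
    and not: "\<not> (v $ 1 = 1/3 \<and> v $ 2 = 1/3)" "\<not> (v $ 1 = 1/3 \<and> v $ 3 = 1/3)"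
      "\<not> (v $ 2 = 1/3 \<and> v $ 3 = 1/3)"
    unfolding menger_T_def by (simp_all add: card_coords_ge_2)
  obtain a b c :: nat where abc: "a \<in> {0, 1, 2}" "b \<in> {0, 1, 2}" "c \<in> {0, 1, 2}"
    and eq: "v $ 1 = a / 3" "v $ 2 = b / 3" "v $ 3 = c / 3"
  proof -
    have third: "\<exists>a\<in>{0, 1, 2 :: nat}. y = a / 3" if "y \<in> {0, 1/3, 2/3}" for y :: real
      using that by auto
    from v[THEN third] show thesis using that by blast
  qed
  have "\<not> (a = 1 \<and> b = 1)" "\<not> (a = 1 \<and> c = 1)" "\<not> (b = 1 \<and> c = 1)"
    using not unfolding eq by auto
  with abc have "(a, b, c) \<in> menger_digits"
    unfolding insert_iff empty_iff menger_digits_def by (elim disjE) simp_all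
  then show "v \<in> vec3 ` menger_digits"
    using eq vec3_eq_iff by blast
next
  fix v assume "v \<in> vec3 ` menger_digits"
  then show "v \<in> menger_T"
    unfolding menger_digits_def menger_T_def
    by (elim imageE insertE emptyE) (simp_all add: vec3_eq_iff forall_3 card_coords_ge_2)
qed

lemma vec3_nth: "vec3 (a, b, c) $ 1 = a / 3" "vec3 (a, b, c) $ 2 = b / 3" "vec3 (a, b, c) $ 3 = c / 3"
  using vec3_eq_iff[of "vec3 (a, b, c)" a b c] by blast+

lemma inj_vec3: "inj vec3"
proof (rule injI)
  fix d e assume "vec3 d = vec3 e"
  moreover obtain a b c a' b' c' where "d = (a, b, c)" "e = (a', b', c')"
    by (metis prod_cases3)
  ultimately show "d = e" by (simp add: vec3_eq_iff vec3_nth)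
qed

text \<open>On \<open>menger_T\<close> the number \<open>3 * proj111 t\<close> is already an
  integer; the floor merely changes its type.\<close>

definition digit :: "real^3 \<Rightarrow> int" where
  "digit t = \<lfloor>3 * proj111 t\<rfloor>"

lemma digit_vec3: "digit (vec3 (a, b, c)) = int (a + b + c)"
proof -
  have "3 * proj111 (vec3 (a, b, c)) = of_int (int (a + b + c))"
    by (simp add: proj111_def vec3_nth)
  then show ?thesis unfolding digit_def by (simp only: floor_of_int)
qed

lemma proj111_menger_T:
  assumes "t \<in> menger_T"
  shows "proj111 t = digit t / 3"
proof -
  obtain a b c where "t = vec3 (a, b, c)"
    using assms by (auto simp: menger_T_eq)
  then show ?thesis by (simp add: digit_vec3 proj111_def vec3_nth)
qed

lemma digit_bounds:
  assumes "t \<in> menger_T"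
  shows "0 \<le> digit t" "digit t \<le> 6"
proof -
  obtain a b c where t: "t = vec3 (a, b, c)" "(a, b, c) \<in> menger_digits"
    using assms by (auto simp: menger_T_eq)
  have "a \<le> 2" "b \<le> 2" "c \<le> 2"
    using t(2) unfolding menger_digits_def by auto
  then show "0 \<le> digit t" "digit t \<le> 6"
    by (simp_all add: t digit_vec3)
qed

lemma sum_menger_T:
  fixes f :: "int \<Rightarrow> real"
  shows "(\<Sum>t\<in>menger_T. f (digit t))
    = f 0 + 3 * f 1 + 3 * f 2 + 6 * f 3 + 3 * f 4 + 3 * f 5 + f 6"
proof -
  have "(\<Sum>t\<in>menger_T. f (digit t)) = (\<Sum>(a, b, c)\<in>menger_digits. f (int (a + b + c)))"
    unfolding menger_T_eq by (subst sum.reindex) (auto simp: inj_vec3[THEN inj_on_subset] digit_vec3 intro!: sum.cong)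
  also have "\<dots> = f 0 + 3 * f 1 + 3 * f 2 + 6 * f 3 + 3 * f 4 + 3 * f 5 + f 6"
    by (simp add: menger_digits_def)
  finally show ?thesis .
qed

lemma finite_menger_T [simp]: "finite menger_T"
  by (simp add: menger_T_eq menger_digits_def)

lemma card_menger_T: "card menger_T = 20"
  unfolding menger_T_eq by (subst card_image[OF inj_on_subset[OF inj_vec3]]) (simp_all add: menger_digits_def)

section \<open>Surviving words and covered cells as functions of a labelling\<close>

definition surv :: "nat \<Rightarrow> ((real^3) list \<Rightarrow> bool) \<Rightarrow> (real^3) list set" where
  "surv n x = {w \<in> menger_words n. \<forall>k\<in>{1..n}. x (take k w)}"

lemma surviving_eq: "surviving X n \<omega> = surv n (\<lambda>w. X w \<omega>)"
  by (simp add: surviving_def surv_def)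

definition menger_index :: "(real^3) list set" where
  "menger_index = (\<Union>n\<in>{1..}. menger_words n)"

lemma mem_menger_index: "w \<in> menger_index \<longleftrightarrow> w \<noteq> [] \<and> set w \<subseteq> menger_T"
  by (cases w) (auto simp: menger_index_def menger_words_def)

lemma finite_menger_words: "finite (menger_words n)"
  using finite_lists_length_eq[of menger_T n] by (simp add: menger_words_def conj_commute)

lemma surv_0: "surv 0 x = {[]}"
  by (auto simp: surv_def menger_words_def)

lemma take_mem_menger_index:
  "w \<in> menger_words n \<Longrightarrow> k \<in> {1..n} \<Longrightarrow> take k w \<in> menger_index"
  by (auto simp: mem_menger_index menger_words_def dest: in_set_takeD)

text \<open>Allows passing between arbitrary labellings and the extensional functions that form the
  product space.\<close>

lemma surv_restrict: "surv n (restrict x menger_index) = surv n x"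
  unfolding surv_def by (auto simp: take_mem_menger_index)

lemma surv_Suc:
  "surv (Suc n) x = (\<Union>t\<in>{t \<in> menger_T. x [t]}. (#) t ` surv n (\<lambda>w. x (t # w)))"
    (is "_ = ?R")
proof (intro set_eqI iffI)
  fix w assume w: "w \<in> surv (Suc n) x"
  then obtain t v where tv: "w = t # v" "t \<in> menger_T" "v \<in> menger_words n"
    by (cases w) (auto simp: surv_def menger_words_def)
  have x: "x (take k w)" if "1 \<le> k" "k \<le> Suc n" for k
    using w that by (auto simp: surv_def)
  have "x [t]" using x[of 1] tv by simp
  moreover have "x (t # take k v)" if "k \<le> n" for k
    using x[of "Suc k"] that tv by simp
  ultimately show "w \<in> ?R" using tv by (auto simp: surv_def)
next
  fix w assume "w \<in> ?R"
  then obtain t v where tv: "w = t # v" "t \<in> menger_T" "x [t]" "v \<in> menger_words n"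
    "\<forall>k\<in>{1..n}. x (t # take k v)"
    by (auto simp: surv_def)
  have "x (take k w)" if "1 \<le> k" "k \<le> Suc n" for k
    using tv that by (cases k; cases "k = 1") auto
  then show "w \<in> surv (Suc n) x"
    using tv by (auto simp: surv_def menger_words_def)
qed

lemma surv_length: "w \<in> surv n x \<Longrightarrow> length w = n"
  and surv_set: "w \<in> surv n x \<Longrightarrow> set w \<subseteq> menger_T"
  by (auto simp: surv_def menger_words_def)

text \<open>\<open>offset w / 3 ^ length w\<close> is the left end point of the projected cube of \<open>w\<close>, which has length
  \<open>3 / 3 ^ length w\<close>; so the cube covers the three triadic cells starting at \<open>offset w\<close>.\<close>

fun offset :: "(real^3) list \<Rightarrow> int" where
  "offset [] = 0"
| "offset (t # w) = 3 ^ length w * digit t + offset w"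

definition covered :: "nat \<Rightarrow> int \<Rightarrow> ((real^3) list \<Rightarrow> bool) \<Rightarrow> bool" where
  "covered n r x \<longleftrightarrow> (\<exists>w\<in>surv n x. offset w \<le> r \<and> r < offset w + 3)"

lemma covered_0: "covered 0 r x \<longleftrightarrow> 0 \<le> r \<and> r < 3"
  by (simp add: covered_def surv_0)

text \<open>Prefixing a letter \<open>t\<close> moves every offset by
  \<open>3 ^ n * digit t\<close>, so covering a cell becomes covering a shifted cell in one of the
  subtrees.\<close>

lemma covered_Suc:
  "covered (Suc n) r x \<longleftrightarrow> (\<exists>t\<in>menger_T. x [t] \<and> covered n (r - 3 ^ n * digit t) (\<lambda>w. x (t # w)))"
proof -
  have offset_Cons: "offset (t # w) = 3 ^ n * digit t + offset w" if "w \<in> surv n y" for t w y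
    using surv_length[OF that] by simp
  have "covered (Suc n) r x \<longleftrightarrow> (\<exists>t\<in>menger_T. x [t] \<and>
      (\<exists>w\<in>surv n (\<lambda>w. x (t # w)). offset (t # w) \<le> r \<and> r < offset (t # w) + 3))"
    unfolding covered_def surv_Suc by blast
  also have "\<dots> \<longleftrightarrow> (\<exists>t\<in>menger_T. x [t] \<and> covered n (r - 3 ^ n * digit t) (\<lambda>w. x (t # w)))"
    unfolding covered_def
    by (intro bex_cong conj_cong refl) (simp_all only: offset_Cons, linarith+)
  finally show ?thesis .
qed

text \<open>The upper bound is the geometric sum obtained when every digit equals 6.\<close>

lemma offset_bounds:
  assumes "set w \<subseteq> menger_T"
  shows "0 \<le> offset w \<and> offset w \<le> 3 * 3 ^ length w - 3"
  using assms
proof (induction w)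
  case (Cons t w)
  have t: "0 \<le> digit t" "digit t \<le> 6"
    using digit_bounds Cons.prems by simp_all
  have l: "0 \<le> 3 ^ length w * digit t"
    using t by simp
  have u: "3 ^ length w * digit t \<le> 3 ^ length w * 6"
    by (rule mult_left_mono[OF t(2)]) simp
  have IH: "0 \<le> offset w" "offset w \<le> 3 * 3 ^ length w - 3"
    using Cons by simp_all
  have "3 * 3 ^ length (t # w) - 3 = 3 ^ length w * 6 + (3 * 3 ^ length w - 3 :: int)"
    by simp
  then show ?case
    using add_nonneg_nonneg[OF l IH(1)] add_mono[OF u IH(2)] by (simp only: offset.simps)
qed simp

lemma covered_range:
  assumes "covered n r x"
  shows "0 \<le> r" "r < 3 * 3 ^ n"
proof -
  obtain w where w: "w \<in> surv n x" "offset w \<le> r" "r < offset w + 3"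
    using assms by (auto simp: covered_def)
  have "0 \<le> offset w" "offset w \<le> 3 * 3 ^ n - 3"
    using offset_bounds[OF surv_set[OF w(1)]] surv_length[OF w(1)] by simp_all
  then show "0 \<le> r" "r < 3 * 3 ^ n" using w by linarith+
qed

section \<open>Projected cubes as triadic intervals\<close>

lemma proj111_menger_map: "proj111 (menger_map t x) = proj111 x / 3 + proj111 t"
  by (simp add: proj111_def menger_map_def)

lemma word_map_simps: "word_map [] = id" "word_map (t # w) = menger_map t \<circ> word_map w"
  by (simp_all add: word_map_def)

lemma proj111_word_map:
  "set w \<subseteq> menger_T \<Longrightarrow> proj111 (word_map w x) = (proj111 x + offset w) / 3 ^ length w"
proof (induction w)
  case (Cons t w)
  have "proj111 (word_map (t # w) x) = (proj111 x + offset w) / 3 ^ length w / 3 + digit t / 3"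
    using Cons by (simp add: word_map_simps proj111_menger_map proj111_menger_T)
  also have "\<dots> = (proj111 x + (3 ^ length w * digit t + offset w)) / (3 ^ length w * 3)"
    by (simp add: add_divide_distrib)
  finally show ?case
    by (simp only: offset.simps of_int_add of_int_mult of_int_power of_int_numeral
        list.size(4) power_add power_one_right add_0_right One_nat_def[symmetric])
qed (simp add: word_map_simps)

lemma proj111_cbox: "proj111 ` cbox 0 1 = {0..3}"
proof (intro set_eqI iffI)
  fix y :: real assume "y \<in> {0..3}"
  then have "(\<chi> i. y / 3) \<in> cbox 0 (1 :: real^3)" "proj111 (\<chi> i. y / 3) = y"
    by (auto simp: mem_box_cart proj111_def)
  then show "y \<in> proj111 ` cbox 0 1" by (metis image_eqI)
next
  fix y assume "y \<in> proj111 ` cbox 0 1"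
  then obtain v where v: "v \<in> cbox 0 1" "y = proj111 v" by auto
  have "0 \<le> v $ i \<and> v $ i \<le> 1" for i
    using v by (simp add: mem_box_cart)
  from this[of 1] this[of 2] this[of 3] v show "y \<in> {0..3}" by (simp add: proj111_def)
qed

lemma proj111_word_map_cbox:
  assumes "set w \<subseteq> menger_T"
  shows "proj111 ` word_map w ` cbox 0 1 = {offset w / 3 ^ length w..(offset w + 3) / 3 ^ length w}"
proof -
  have "proj111 ` word_map w ` cbox 0 1 = (\<lambda>y. (y + offset w) / 3 ^ length w) ` proj111 ` cbox 0 1"
    using assms by (simp add: image_image proj111_word_map)
  also have "\<dots> = (\<lambda>y. (1 / 3 ^ length w) * y + offset w / 3 ^ length w) ` {0..3}"
    unfolding proj111_cbox by (intro image_cong) (auto simp: add_divide_distrib)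
  also have "\<dots> = {offset w / 3 ^ length w..(offset w + 3) / 3 ^ length w}"
    by (subst image_affinity_atLeastAtMost) (simp add: add_divide_distrib add.commute)
  finally show ?thesis .
qed

definition shadow :: "nat \<Rightarrow> ((real^3) list \<Rightarrow> bool) \<Rightarrow> real set" where
  "shadow n x = (\<Union>w\<in>surv n x. {offset w / 3 ^ n..(offset w + 3) / 3 ^ n})"

lemma finite_surv: "finite (surv n x)"
  using finite_menger_words[of n] by (auto simp: surv_def)

lemma compact_shadow: "compact (shadow n x)"
  unfolding shadow_def by (intro compact_UN finite_surv) auto

lemma shadow_sets [measurable]: "shadow n x \<in> sets borel"
  using compact_shadow by (intro borel_compact)

lemma shadow_eq_proj: "shadow n x = proj111 ` (\<Union>w\<in>surv n x. word_map w ` cbox 0 1)"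
  unfolding shadow_def image_UN
  by (intro SUP_cong refl) (metis proj111_word_map_cbox surv_length surv_set)

lemma affine_image_cell:
  assumes "length w = n"
  shows "(\<lambda>y. y / 3 + digit t / 3) ` {offset w / 3 ^ n..(offset w + 3) / 3 ^ n}
    = {offset (t # w) / 3 ^ Suc n..(offset (t # w) + 3) / 3 ^ Suc n}"
proof -
  have end_point: "1 / 3 * (a / 3 ^ n) + digit t / 3 = (3 ^ n * digit t + a) / 3 ^ Suc n" for a :: real
    by (simp add: field_simps)
  have "(\<lambda>y. y / 3 + digit t / 3) ` {offset w / 3 ^ n..(offset w + 3) / 3 ^ n}
    = (\<lambda>y. (1 / 3) * y + digit t / 3) ` {offset w / 3 ^ n..(offset w + 3) / 3 ^ n}"
    by simp
  also have "\<dots> = {1 / 3 * (offset w / 3 ^ n) + digit t / 3..1 / 3 * ((offset w + 3) / 3 ^ n) + digit t / 3}"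
    by (subst image_affinity_atLeastAtMost) (simp add: divide_right_mono)
  finally show ?thesis
    unfolding end_point offset.simps assms
    by (simp only: of_int_add of_int_mult of_int_power of_int_numeral add.assoc)
qed

lemma shadow_Suc:
  "shadow (Suc n) x = (\<Union>t\<in>{t \<in> menger_T. x [t]}. (\<lambda>y. y / 3 + digit t / 3) ` shadow n (\<lambda>w. x (t # w)))"
proof -
  have "(\<Union>w\<in>(#) t ` surv n y. {offset w / 3 ^ Suc n..(offset w + 3) / 3 ^ Suc n})
      = (\<lambda>y. y / 3 + digit t / 3) ` (\<Union>w\<in>surv n y. {offset w / 3 ^ n..(offset w + 3) / 3 ^ n})" for t y
    unfolding image_UN image_image by (intro SUP_cong refl affine_image_cell[symmetric] surv_length)
  then show ?thesis
    unfolding shadow_def surv_Suc UN_UN_flatten by simp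
qed

text \<open>Each covered cell lies in the shadow and contributes length \<open>1 / 3 ^ n\<close>.
  The cells are taken half-open so that they are disjoint.\<close>

lemma measure_shadow_ge:
  "(\<Sum>r<3 ^ Suc n. of_bool (covered n (int r) x)) \<le> 3 ^ n * measure lborel (shadow n x)"
proof -
  define R where "R = {r. r < 3 ^ Suc n \<and> covered n (int r) x}"
  define I where "I r = {real r / 3 ^ n..<(real r + 1) / 3 ^ n}" for r :: nat
  have fin: "finite R" by (simp add: R_def)
  have "disjoint_family_on I R"
  proof -
    have "I r \<inter> I s = {}" if "r \<noteq> s" for r s
    proof (rule equals0I)
      fix y assume "y \<in> I r \<inter> I s"
      then have "real r \<le> y * 3 ^ n" "y * 3 ^ n < real r + 1" "real s \<le> y * 3 ^ n" "y * 3 ^ n < real s + 1"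
        by (simp_all add: I_def pos_divide_le_eq pos_less_divide_eq)
      with that show False by linarith
    qed
    then show ?thesis by (simp add: disjoint_family_on_def)
  qed
  moreover have I: "emeasure lborel (I r) = ennreal (1 / 3 ^ n)" for r
    by (simp add: I_def divide_right_mono flip: diff_divide_distrib)
  ultimately have "measure lborel (\<Union>r\<in>R. I r) = (\<Sum>r\<in>R. measure lborel (I r))"
    using fin by (intro measure_finite_Union) (auto simp: I_def[symmetric], simp add: I_def)
  also have "\<dots> = (\<Sum>r\<in>R. 1 / 3 ^ n)"
    by (simp add: measure_def I)
  finally have "real (card R) = 3 ^ n * measure lborel (\<Union>r\<in>R. I r)"
    by simp
  also have "\<dots> \<le> 3 ^ n * measure lborel (shadow n x)"
  proof (intro mult_left_mono measure_mono_fmeasurable)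
    show "(\<Union>r\<in>R. I r) \<subseteq> shadow n x"
    proof
      fix y assume "y \<in> (\<Union>r\<in>R. I r)"
      then obtain r w where r: "real r / 3 ^ n \<le> y" "y < (real r + 1) / 3 ^ n"
        and w: "w \<in> surv n x" "offset w \<le> int r" "int r < offset w + 3"
        by (auto simp: R_def I_def covered_def)
      have "real_of_int (offset w) / 3 ^ n \<le> real r / 3 ^ n"
        using w by (intro divide_right_mono) (linarith, simp)
      moreover have "(real r + 1) / 3 ^ n \<le> (real_of_int (offset w) + 3) / 3 ^ n"
        using w by (intro divide_right_mono) (linarith, simp)
      ultimately show "y \<in> shadow n x"
        using r w by (force simp: shadow_def)
    qed
    show "shadow n x \<in> fmeasurable lborel"
      using compact_shadow by (rule fmeasurable_compact)
  qed (auto simp: I_def)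
  also have "card R = (\<Sum>r<3 ^ Suc n. of_bool (covered n (int r) x))"
    by (simp add: R_def sum.If_cases of_bool_def Int_def lessThan_def)
  finally show ?thesis by simp
qed

lemma shadow_0: "shadow 0 x = {0..3}"
  by (simp add: shadow_def surv_0)

text \<open>Peeling off the first letter reduces the claim to the subtrees. At the bottom, digits
  between 0 and 6 make \<open>y / 3 + digit t / 3\<close> map \<open>{0..3}\<close> into
  itself.\<close>

lemma shadow_decreasing: "shadow (Suc n) x \<subseteq> shadow n x"
proof (induction n arbitrary: x)
  case 0
  have "y / 3 + digit t / 3 \<in> {0..3}" if "t \<in> menger_T" "y \<in> {0..3}" for t y
    using digit_bounds[OF that(1)] that(2) by simp
  then show ?case
    unfolding shadow_Suc[of 0] shadow_0 by blast
next
  case (Suc n)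
  show ?case
    unfolding shadow_Suc[of "Suc n" x] shadow_Suc[of n x] by (intro UN_mono image_mono Suc.IH order.refl)
qed

lemma shadow_antimono: "decseq (\<lambda>n. shadow n x)"
  using shadow_decreasing by (rule decseq_SucI)

lemma shadow_subset: "shadow n x \<subseteq> {0..3}"
  using decseqD[OF shadow_antimono, of 0 n x] by (simp add: shadow_0)

section \<open>Vanishing length and extinction\<close>

definition vanishing :: "((real^3) list \<Rightarrow> bool) \<Rightarrow> bool" where
  "vanishing x \<longleftrightarrow> (\<lambda>n. measure lborel (shadow n x)) \<longlonglongrightarrow> 0"

definition extinct :: "((real^3) list \<Rightarrow> bool) \<Rightarrow> bool" where
  "extinct x \<longleftrightarrow> (\<exists>n. surv n x = {})"

lemma measure_affine_shadow:
  "measure lborel ((\<lambda>y. y / 3 + c) ` shadow n x) = measure lborel (shadow n x) / 3"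
proof -
  let ?A = "(\<lambda>y. y / 3 + c) ` shadow n x"
  have [measurable]: "?A \<in> sets borel"
    by (intro borel_compact compact_continuous_image compact_shadow continuous_intros) auto
  have "inj (\<lambda>y. y / 3 + c)" by (simp add: inj_def)
  then have ind: "indicator ?A (c + y / 3) = (indicator (shadow n x) y :: ennreal)" for y
    using inj_image_mem_iff[of "\<lambda>y. y / 3 + c" y "shadow n x"] by (simp add: indicator_def add.commute)
  have "emeasure lborel ?A = ennreal (1 / 3) * emeasure lborel (shadow n x)"
    using nn_integral_real_affine[of "indicator ?A" "1 / 3" c] by (simp add: ind)
  then show ?thesis
    by (simp add: measure_def enn2real_mult)
qed

text \<open>The length at level \<open>Suc n\<close> lies between one third of the length of any
  retained branch at level \<open>n\<close> and the sum of these thirds, so it tends to 0 exactly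
  when all retained branches do.\<close>

lemma vanishing_iff:
  "vanishing x \<longleftrightarrow> (\<forall>t\<in>menger_T. \<not> (x [t] \<and> \<not> vanishing (\<lambda>w. x (t # w))))"
proof -
  let ?S = "{t \<in> menger_T. x [t]}"
  let ?l = "\<lambda>n x. measure lborel (shadow n x)"
  have fm: "(\<lambda>y. y / 3 + c) ` shadow n x \<in> fmeasurable lborel" for c n x
    by (intro fmeasurable_compact compact_continuous_image compact_shadow continuous_intros) auto
  have ge: "?l n (\<lambda>w. x (t # w)) \<le> 3 * ?l (Suc n) x" if "t \<in> ?S" for t n
  proof -
    have "?l n (\<lambda>w. x (t # w)) / 3 \<le> ?l (Suc n) x"
      unfolding measure_affine_shadow[of "digit t / 3", symmetric]
    proof (rule measure_mono_fmeasurable)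
      show "(\<lambda>y. y / 3 + digit t / 3) ` shadow n (\<lambda>w. x (t # w)) \<subseteq> shadow (Suc n) x"
        using that unfolding shadow_Suc by blast
    qed (use fmeasurable_compact[OF compact_shadow] fmeasurableD[OF fm] in auto)
    then show ?thesis by simp
  qed
  have le: "?l (Suc n) x \<le> (\<Sum>t\<in>?S. ?l n (\<lambda>w. x (t # w)) / 3)" for n
    unfolding shadow_Suc by (rule order.trans[OF measure_UNION_le])
      (use fmeasurableD[OF fm] in \<open>auto simp: measure_affine_shadow\<close>)
  show ?thesis
  proof
    assume "vanishing x"
    then have lim: "(\<lambda>n. 3 * ?l (Suc n) x) \<longlonglongrightarrow> 0"
      unfolding vanishing_def by (auto dest: LIMSEQ_Suc intro: tendsto_mult_right_zero)
    have "vanishing (\<lambda>w. x (t # w))" if "t \<in> ?S" for t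
      unfolding vanishing_def
      by (rule tendsto_sandwich[OF _ _ tendsto_const lim]) (use ge that in auto)
    then show "\<forall>t\<in>menger_T. \<not> (x [t] \<and> \<not> vanishing (\<lambda>w. x (t # w)))" by auto
  next
    assume *: "\<forall>t\<in>menger_T. \<not> (x [t] \<and> \<not> vanishing (\<lambda>w. x (t # w)))"
    have lim: "(\<lambda>n. \<Sum>t\<in>?S. ?l n (\<lambda>w. x (t # w)) / 3) \<longlonglongrightarrow> (\<Sum>t\<in>?S. 0 / 3)"
      using * by (intro tendsto_intros) (auto simp: vanishing_def)
    have "(\<lambda>n. ?l (Suc n) x) \<longlonglongrightarrow> 0"
      by (rule tendsto_sandwich[OF _ _ tendsto_const lim[simplified]]) (use le in auto)
    then show "vanishing x"
      unfolding vanishing_def by (rule LIMSEQ_imp_Suc)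
  qed
qed

lemma surv_empty_mono:
  assumes "surv n x = {}" "n \<le> m"
  shows "surv m x = {}"
proof (rule ccontr)
  assume "surv m x \<noteq> {}"
  then obtain w where "w \<in> surv m x" by auto
  then have "take n w \<in> surv n x"
    using assms(2) by (auto simp: surv_def menger_words_def min_def dest: in_set_takeD)
  with assms show False by simp
qed

lemma extinct_iff:
  "extinct x \<longleftrightarrow> (\<forall>t\<in>menger_T. \<not> (x [t] \<and> \<not> extinct (\<lambda>w. x (t # w))))"
proof
  assume "extinct x"
  then obtain n where "surv n x = {}" by (auto simp: extinct_def)
  then have "surv (Suc n) x = {}" by (rule surv_empty_mono) simp
  then show "\<forall>t\<in>menger_T. \<not> (x [t] \<and> \<not> extinct (\<lambda>w. x (t # w)))"
    by (auto simp: surv_Suc extinct_def)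
next
  assume "\<forall>t\<in>menger_T. \<not> (x [t] \<and> \<not> extinct (\<lambda>w. x (t # w)))"
  then have "\<forall>t\<in>{t \<in> menger_T. x [t]}. \<exists>n. surv n (\<lambda>w. x (t # w)) = {}"
    by (auto simp: extinct_def)
  from bchoice[OF this] obtain N where N: "\<And>t. t \<in> menger_T \<Longrightarrow> x [t] \<Longrightarrow> surv (N t) (\<lambda>w. x (t # w)) = {}"
    by auto
  \<comment> \<open>Finitely many branches become extinct at possibly different levels; extinction
    persists, so the maximum serves all of them.\<close>
  define m where "m = Max (N ` menger_T)"
  have "surv m (\<lambda>w. x (t # w)) = {}" if "t \<in> menger_T" "x [t]" for t
    using surv_empty_mono[OF N[OF that]] that by (simp add: m_def)
  then have "surv (Suc m) x = {}" by (auto simp: surv_Suc)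
  then show "extinct x" by (auto simp: extinct_def)
qed

lemma extinct_imp_vanishing:
  assumes "extinct x"
  shows "vanishing x"
proof -
  obtain n where n: "surv n x = {}" using assms by (auto simp: extinct_def)
  have "eventually (\<lambda>m. measure lborel (shadow m x) = 0) sequentially"
    using eventually_ge_at_top[of n] by eventually_elim (simp add: shadow_def surv_empty_mono[OF n])
  then show ?thesis unfolding vanishing_def by (rule tendsto_eventually)
qed

lemma shadow_INT_measure:
  "(\<lambda>n. measure lborel (shadow n x)) \<longlonglongrightarrow> measure lborel (\<Inter>n. shadow n x)"
proof (rule Lim_measure_decseq)
  show "emeasure lborel (shadow n x) \<noteq> \<infinity>" for n
    using emeasure_mono[OF shadow_subset[of n x], of lborel] by (auto simp: top_unique)
qed (use shadow_antimono in auto)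

text \<open>Continuity from above identifies the limit of the lengths with the length of the
  intersection. That length is finite because everything lies in \<open>{0..3}\<close>, so real and
  extended measure vanish together.\<close>

lemma vanishing_eq_null: "vanishing x \<longleftrightarrow> emeasure lborel (\<Inter>n. shadow n x) = 0"
proof -
  have "(\<Inter>n. shadow n x) \<subseteq> {0..3}" using shadow_subset by blast
  then have "emeasure lborel (\<Inter>n. shadow n x) \<le> emeasure lborel {0..3::real}"
    by (intro emeasure_mono) auto
  then have "emeasure lborel (\<Inter>n. shadow n x) \<noteq> \<infinity>" by (auto simp: top_unique)
  then have "measure lborel (\<Inter>n. shadow n x) = 0 \<longleftrightarrow> emeasure lborel (\<Inter>n. shadow n x) = 0"
    by (simp add: measure_def enn2real_eq_0_iff)
  moreover have "vanishing x \<longleftrightarrow> measure lborel (\<Inter>n. shadow n x) = 0"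
    unfolding vanishing_def using shadow_INT_measure[of x] LIMSEQ_unique by auto
  ultimately show ?thesis by blast
qed

text \<open>Projection commutes with the intersection because the approximations are compact and
  nested: over a point of every projection the fibres form a decreasing sequence of nonempty compact
  sets.\<close>

lemma proj111_random_menger:
  "proj111 ` random_menger X \<omega> = (\<Inter>n. shadow n (\<lambda>w. X w \<omega>))"
proof -
  define x where "x = (\<lambda>w. X w \<omega>)"
  define C where "C n = (\<Union>w\<in>surv n x. word_map w ` cbox 0 1)" for n
  have cont: "continuous_on A (word_map w)" for w A
    by (induction w arbitrary: A)
      (auto simp: word_map_simps menger_map_def o_def intro!: continuous_intros)
  have contp: "continuous_on A proj111" for A
    unfolding proj111_def by (intro continuous_intros)
  have compact: "compact (C n)" for n
    unfolding C_def by (intro compact_UN finite_surv compact_continuous_image cont compact_cbox)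
  have map_cube: "menger_map t ` cbox 0 1 \<subseteq> cbox 0 1" if "t \<in> menger_T" for t
  proof -
    have t: "0 \<le> t $ i \<and> t $ i \<le> 2 / 3" for i
    proof -
      have "t $ i \<in> {0, 1 / 3, 2 / 3}" using that by (simp add: menger_T_def)
      then show ?thesis by auto
    qed
    show ?thesis
    proof
      fix y assume "y \<in> menger_map t ` cbox 0 1"
      then obtain v where "v \<in> cbox 0 1" and y: "y = menger_map t v" by auto
      then have v: "0 \<le> v $ i \<and> v $ i \<le> 1" for i
        by (simp add: mem_box_cart)
      have "0 \<le> y $ i \<and> y $ i \<le> 1" for i
        using v[of i] t[of i] by (simp add: y menger_map_def)
      then show "y \<in> cbox 0 1" by (simp add: mem_box_cart)
    qed
  qed
  have map_append: "word_map (v @ [t]) = word_map v \<circ> menger_map t" for v t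
    by (induction v) (auto simp: word_map_simps)
  have "C (Suc n) \<subseteq> C n" for n
  proof
    fix y assume "y \<in> C (Suc n)"
    then obtain w z where w: "w \<in> surv (Suc n) x" and y: "y = word_map w z" and z: "z \<in> cbox 0 1"
      by (auto simp: C_def)
    obtain v t where vt: "w = v @ [t]" "length v = n"
      using surv_length[OF w] by (cases w rule: rev_cases) auto
    have x: "x (take k w)" if "k \<in> {1..Suc n}" for k
      using w that by (simp add: surv_def)
    have "x (take k v)" if "k \<in> {1..n}" for k
      using x[of k] that vt by simp
    then have v: "v \<in> surv n x" and t: "t \<in> menger_T"
      using w vt by (auto simp: surv_def menger_words_def)
    have "y = word_map v (menger_map t z)" using y vt map_append by simp
    then show "y \<in> C n" using v map_cube[OF t] z by (auto simp: C_def)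
  qed
  then have dec: "C m \<subseteq> C n" if "n \<le> m" for m n
    using that lift_Suc_antimono_le[of C] by blast
  have "random_menger X \<omega> = (\<Inter>n\<in>{1..}. C n)"
    by (simp add: random_menger_def surviving_eq x_def C_def)
  \<comment> \<open>The intersection defining the sponge starts at level 1; adding level 0 changes
    nothing because the sets decrease.\<close>
  also have "\<dots> = (\<Inter>n. C n)"
  proof
    show "(\<Inter>n\<in>{1..}. C n) \<subseteq> (\<Inter>n. C n)"
    proof (rule INT_greatest)
      fix n
      have "(\<Inter>n\<in>{1..}. C n) \<subseteq> C (Suc n)" by (rule INT_lower) simp
      also have "C (Suc n) \<subseteq> C n" by (rule dec) simp
      finally show "(\<Inter>n\<in>{1..}. C n) \<subseteq> C n" .
    qed
    show "(\<Inter>n. C n) \<subseteq> (\<Inter>n\<in>{1..}. C n)"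
      by (rule INF_superset_mono) simp_all
  qed
  finally have "random_menger X \<omega> = (\<Inter>n. C n)" .
  moreover have "proj111 ` (\<Inter>n. C n) = (\<Inter>n. proj111 ` C n)"
  proof (intro equalityI subsetI)
    fix y assume y: "y \<in> (\<Inter>n. proj111 ` C n)"
    define F where "F n = C n \<inter> proj111 -` {y}" for n
    have "closed (proj111 -` {y})"
      using continuous_closed_vimage[of "{y}" proj111] contp[of UNIV]
      by (simp add: continuous_on_eq_continuous_at)
    then have "compact (F n)" for n
      unfolding F_def using compact by (intro compact_Int_closed)
    moreover have "F n \<noteq> {}" for n
      using y by (auto simp: F_def)
    moreover have "F m \<subseteq> F n" if "n \<le> m" for m n
      using dec[OF that] by (auto simp: F_def)
    ultimately have "\<Inter>(range F) \<noteq> {}" by (rule compact_nest)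
    then show "y \<in> proj111 ` (\<Inter>n. C n)" by (force simp: F_def)
  qed auto
  moreover have "proj111 ` C n = shadow n x" for n
    by (simp add: C_def shadow_eq_proj)
  ultimately show ?thesis by (simp add: x_def)
qed

section \<open>Independence of the subtrees\<close>

text \<open>The common law of the labels of the whole tree and of each subtree; it gives
  probabilities that do not refer to a particular realisation.\<close>

definition label_space :: "real \<Rightarrow> ((real^3) list \<Rightarrow> bool) measure" where
  "label_space p = (\<Pi>\<^sub>M w\<in>menger_index. measure_pmf (bernoulli_pmf p))"

lemma sets_label_space: "sets (label_space p) = sets (\<Pi>\<^sub>M w\<in>menger_index. count_space UNIV)"
  unfolding label_space_def by (intro sets_PiM_cong) simp_all

lemma space_label_space: "space (label_space p) = (\<Pi>\<^sub>E w\<in>menger_index. UNIV)"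
  by (simp add: label_space_def space_PiM)

lemma prob_space_label_space: "prob_space (label_space p)"
  unfolding label_space_def by (intro prob_space_PiM measure_pmf.prob_space_axioms)

lemma sets_label: "w \<in> menger_index \<Longrightarrow> {x \<in> space (label_space p). x w} \<in> sets (label_space p)"
  by (subst sets_label_space, subst space_label_space)
    (use measurable_sets[OF measurable_component_singleton[of w menger_index "\<lambda>_. count_space UNIV"], of "{True}"]
      in \<open>simp add: vimage_def Int_def space_PiM conj_commute\<close>)

text \<open>Only finitely many values are possible, and each is attained on a finite Boolean
  combination of label events.\<close>

lemma measurable_surv: "surv n \<in> label_space p \<rightarrow>\<^sub>M count_space (Pow (menger_words n))"
proof (subst measurable_count_space_eq2)
  have "{x \<in> space (label_space p). surv n x = U} \<in> sets (label_space p)"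
    if "U \<subseteq> menger_words n" for U
  proof -
    have "{x \<in> space (label_space p). surv n x = U}
        = {x \<in> space (label_space p). \<forall>w\<in>menger_words n. (\<forall>k\<in>{1..n}. x (take k w)) \<longleftrightarrow> w \<in> U}"
      using that by (auto simp: surv_def)
    also have "\<dots> \<in> sets (label_space p)"
    proof (intro sets.sets_Collect_finite_All finite_menger_words)
      fix w assume w: "w \<in> menger_words n"
      have *: "{x \<in> space (label_space p). \<forall>k\<in>{1..n}. x (take k w)} \<in> sets (label_space p)"
        by (intro sets.sets_Collect_finite_All sets_label take_mem_menger_index[OF w]) auto
      then show "{x \<in> space (label_space p). (\<forall>k\<in>{1..n}. x (take k w)) = (w \<in> U)} \<in> sets (label_space p)"
        by (cases "w \<in> U") (simp_all add: sets.sets_Collect_neg[OF *, simplified])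
    qed
    finally show ?thesis .
  qed
  then show "surv n \<in> space (label_space p) \<rightarrow> Pow (menger_words n) \<and>
      (\<forall>U\<in>Pow (menger_words n). surv n -` {U} \<inter> space (label_space p) \<in> sets (label_space p))"
    by (auto simp: vimage_def Int_def conj_commute surv_def)
qed (use finite_menger_words in simp)

lemma surv_comp_measurable:
  assumes "range f \<subseteq> space N"
  shows "(\<lambda>x. f (surv n x)) \<in> label_space p \<rightarrow>\<^sub>M N"
  using assms by (intro measurable_compose[OF measurable_surv]) auto

text \<open>Invariance under restriction is required because \<open>\<lambda>w. x (t # w)\<close>
  need not be extensional, so shifted labellings can lie outside the product space.\<close>

definition label_event :: "(((real^3) list \<Rightarrow> bool) \<Rightarrow> bool) \<Rightarrow> bool" where
  "label_event P \<longleftrightarrow> (\<forall>p. {x \<in> space (label_space p). P x} \<in> sets (label_space p))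
     \<and> (\<forall>x. P (restrict x menger_index) \<longleftrightarrow> P x)"

lemma label_event_cong:
  assumes "label_event P" "\<And>w. w \<in> menger_index \<Longrightarrow> x w = y w"
  shows "P x \<longleftrightarrow> P y"
proof -
  have "restrict x menger_index = restrict y menger_index"
    using assms(2) by (auto simp: restrict_def)
  then show ?thesis
    using assms(1) unfolding label_event_def by metis
qed

lemma sets_coordinate:
  assumes "v \<in> J"
  shows "{x \<in> space (\<Pi>\<^sub>M w\<in>J. count_space (UNIV :: bool set)). x v}
    \<in> sets (\<Pi>\<^sub>M w\<in>J. count_space UNIV)"
  using measurable_sets[OF measurable_component_singleton[OF assms, of "\<lambda>_. count_space UNIV"], of "{True}"]
  by (simp add: vimage_def Int_def conj_commute)

lemma sets_shifted:
  assumes "label_event Q" "(#) t ` menger_index \<subseteq> J"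
  shows "{x \<in> space (\<Pi>\<^sub>M w\<in>J. count_space UNIV). Q (\<lambda>w. x (t # w))}
    \<in> sets (\<Pi>\<^sub>M w\<in>J. count_space UNIV)"
proof -
  let ?f = "\<lambda>x. \<lambda>w\<in>menger_index. x (t # w)"
  have f: "?f \<in> (\<Pi>\<^sub>M w\<in>J. count_space UNIV) \<rightarrow>\<^sub>M label_space p" for p
    by (subst measurable_cong_sets[OF refl sets_label_space])
      (use assms(2) in \<open>auto intro!: measurable_restrict measurable_component_singleton\<close>)
  \<comment> \<open>The parameter 0 is a placeholder, since the sigma-algebra of
    \<open>label_space p\<close> is the same for all \<open>p\<close>.\<close>
  have eq: "?f -` {x \<in> space (label_space 0). Q x} \<inter> space (\<Pi>\<^sub>M w\<in>J. count_space UNIV)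
    = {x \<in> space (\<Pi>\<^sub>M w\<in>J. count_space UNIV). Q (\<lambda>w. x (t # w))}"
  proof -
    have "Q (?f x) \<longleftrightarrow> Q (\<lambda>w. x (t # w))" for x
      by (intro label_event_cong[OF assms(1)]) simp
    moreover have "?f x \<in> space (label_space 0)" for x
      by (simp add: space_label_space)
    ultimately show ?thesis by blast
  qed
  have "{x \<in> space (label_space 0). Q x} \<in> sets (label_space 0)"
    using assms(1) by (simp add: label_event_def)
  from measurable_sets[OF f this] show ?thesis
    by (simp only: eq)
qed

lemma label_event_surv: "label_event (\<lambda>x. f (surv n x))"
  unfolding label_event_def surv_restrict
  using measurable_sets[OF surv_comp_measurable[of f "count_space UNIV"], of "{True}"]
  by (auto simp: vimage_def Int_def conj_commute)

lemma label_event_covered: "label_event (covered n r)"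
  using label_event_surv[of "\<lambda>S. \<exists>w\<in>S. offset w \<le> r \<and> r < offset w + 3" n]
  by (simp add: covered_def[abs_def])

lemma label_event_neg: "label_event P \<Longrightarrow> label_event (\<lambda>x. \<not> P x)"
  unfolding label_event_def by (auto intro: sets.sets_Collect_neg)

lemma label_event_Ex: "(\<And>n::nat. label_event (P n)) \<Longrightarrow> label_event (\<lambda>x. \<exists>n. P n x)"
  unfolding label_event_def by (auto intro: sets.sets_Collect_countable_Ex)

lemma label_event_All: "(\<And>n::nat. label_event (P n)) \<Longrightarrow> label_event (\<lambda>x. \<forall>n. P n x)"
  unfolding label_event_def by (auto intro: sets.sets_Collect_countable_All)

lemma label_event_extinct: "label_event extinct"
  unfolding extinct_def[abs_def]
  by (intro label_event_Ex label_event_surv[of "\<lambda>S. S = {}", simplified])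

text \<open>As the lengths decrease with the level, convergence to 0 only asks for arbitrarily small
  values. This form uses countable quantifiers and is therefore measurable.\<close>

lemma vanishing_iff_small: "vanishing x \<longleftrightarrow> (\<forall>k. \<exists>n. measure lborel (shadow n x) < inverse (real (Suc k)))"
proof
  assume "vanishing x"
  show "\<forall>k. \<exists>n. measure lborel (shadow n x) < inverse (real (Suc k))"
  proof
    fix k
    have "eventually (\<lambda>n. measure lborel (shadow n x) < inverse (real (Suc k))) sequentially"
      by (rule order_tendstoD(2)[OF \<open>vanishing x\<close>[unfolded vanishing_def]]) simp
    then show "\<exists>n. measure lborel (shadow n x) < inverse (real (Suc k))"
      by (auto dest: eventually_happens)
  qed
next
  assume small: "\<forall>k. \<exists>n. measure lborel (shadow n x) < inverse (real (Suc k))"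
  show "vanishing x"
    unfolding vanishing_def
  proof (rule order_tendstoI)
    fix a :: real assume "0 < a"
    then obtain k where "inverse (real (Suc k)) < a" using reals_Archimedean by blast
    then obtain n where n: "measure lborel (shadow n x) < a" using small by (meson less_trans)
    have "measure lborel (shadow m x) \<le> measure lborel (shadow n x)" if "n \<le> m" for m
      using decseqD[OF shadow_antimono that] fmeasurable_compact[OF compact_shadow]
      by (intro measure_mono_fmeasurable) auto
    with n show "eventually (\<lambda>m. measure lborel (shadow m x) < a) sequentially"
      unfolding eventually_sequentially by (meson le_less_trans)
  next
    fix a :: real assume "a < 0"
    then have "a < measure lborel (shadow n x)" for n
      using measure_nonneg[of lborel "shadow n x"] by linarith
    then show "eventually (\<lambda>n. a < measure lborel (shadow n x)) sequentially"
      by (intro always_eventually allI)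
  qed
qed

lemma label_event_vanishing: "label_event vanishing"
  unfolding vanishing_iff_small[abs_def] shadow_def
  by (intro label_event_All label_event_Ex label_event_surv)

section \<open>Probabilities of label events and the branching recursion\<close>

definition label_prob :: "real \<Rightarrow> (((real^3) list \<Rightarrow> bool) \<Rightarrow> bool) \<Rightarrow> real" where
  "label_prob p P = measure (label_space p) {x \<in> space (label_space p). P x}"

lemma label_prob_bounds: "0 \<le> label_prob p P" "label_prob p P \<le> 1"
  unfolding label_prob_def by (simp_all add: prob_space.prob_le_1[OF prob_space_label_space])

locale menger_labels = prob_space M for M :: "'w measure" +
  fixes p :: real and X :: "(real^3) list \<Rightarrow> 'w \<Rightarrow> bool"
  assumes p01: "0 < p" "p < 1"
    and labels: "bernoulli_labels M p X"
begin

lemma indep_labels: "indep_vars (\<lambda>_. count_space UNIV) X menger_index"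
  and distr_label: "w \<in> menger_index \<Longrightarrow> distr M (count_space UNIV) (X w) = measure_pmf (bernoulli_pmf p)"
  using labels unfolding bernoulli_labels_def menger_index_def[symmetric] by blast+

lemma measurable_label [measurable]: "w \<in> menger_index \<Longrightarrow> X w \<in> M \<rightarrow>\<^sub>M count_space UNIV"
  using indep_labels by (simp add: indep_vars_def)

lemma menger_index_nonempty: "menger_index \<noteq> {}"
proof -
  have "menger_T \<noteq> {}" using card_menger_T by auto
  then obtain t where "t \<in> menger_T" by auto
  then have "[t] \<in> menger_index" by (simp add: mem_menger_index)
  then show ?thesis by auto
qed

lemma measurable_labelling: "(\<lambda>\<omega>. \<lambda>w\<in>menger_index. X w \<omega>) \<in> M \<rightarrow>\<^sub>M label_space p"
  by (subst measurable_cong_sets[OF refl sets_label_space]) (intro measurable_restrict measurable_label)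

lemma distr_labelling: "distr M (label_space p) (\<lambda>\<omega>. \<lambda>w\<in>menger_index. X w \<omega>) = label_space p"
proof -
  have "distr M (label_space p) (\<lambda>\<omega>. \<lambda>w\<in>menger_index. X w \<omega>)
      = distr M (\<Pi>\<^sub>M w\<in>menger_index. count_space UNIV) (\<lambda>\<omega>. \<lambda>w\<in>menger_index. X w \<omega>)"
    by (intro distr_cong refl sets_label_space)
  also have "\<dots> = (\<Pi>\<^sub>M w\<in>menger_index. distr M (count_space UNIV) (X w))"
    using indep_vars_iff_distr_eq_PiM'[OF menger_index_nonempty, where X = X and M' = "\<lambda>_. count_space UNIV"]
      indep_labels by simp
  also have "\<dots> = label_space p"
    unfolding label_space_def by (intro PiM_cong refl distr_label)
  finally show ?thesis .
qed

lemma event_labels: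
  assumes "label_event P"
  shows "{\<omega> \<in> space M. P (\<lambda>w. X w \<omega>)} \<in> sets M"
    and "prob {\<omega> \<in> space M. P (\<lambda>w. X w \<omega>)} = label_prob p P"
proof -
  let ?A = "{x \<in> space (label_space p). P x}"
  have A: "?A \<in> sets (label_space p)" using assms by (simp add: label_event_def)
  have eq: "(\<lambda>\<omega>. \<lambda>w\<in>menger_index. X w \<omega>) -` ?A \<inter> space M = {\<omega> \<in> space M. P (\<lambda>w. X w \<omega>)}"
    using assms measurable_space[OF measurable_labelling] by (auto simp: label_event_def)
  show "{\<omega> \<in> space M. P (\<lambda>w. X w \<omega>)} \<in> sets M"
    using measurable_sets[OF measurable_labelling A] by (simp only: eq)
  show "prob {\<omega> \<in> space M. P (\<lambda>w. X w \<omega>)} = label_prob p P"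
    using measure_distr[OF measurable_labelling A] by (simp only: eq distr_labelling label_prob_def)
qed

lemma prob_label: "w \<in> menger_index \<Longrightarrow> prob {\<omega> \<in> space M. X w \<omega>} = p"
  using measure_distr[OF measurable_label, of w "{True}"] p01
  by (simp add: distr_label vimage_def Int_def conj_commute measure_pmf_single)

text \<open>The words below \<open>t\<close> carry independent labels with the same law, so
  everything proved for the tree applies to the subtree at \<open>t\<close>.\<close>

lemma shift_labels:
  assumes t: "t \<in> menger_T"
  shows "menger_labels M p (\<lambda>w. X (t # w))"
proof unfold_locales
  have mem: "t # w \<in> menger_index" if "w \<in> menger_index" for w
    using that t by (simp add: mem_menger_index)
  have "indep_vars (\<lambda>w. \<Pi>\<^sub>M v\<in>{t # w}. count_space UNIV) (\<lambda>w \<omega>. \<lambda>v\<in>{t # w}. X v \<omega>) menger_index"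
    by (intro indep_vars_restrict[OF indep_labels]) (auto simp: mem disjoint_family_on_def)
  then have "indep_vars (\<lambda>_. count_space UNIV) (\<lambda>w \<omega>. (\<lambda>v\<in>{t # w}. X v \<omega>) (t # w)) menger_index"
    by (rule indep_vars_compose2) (auto intro: measurable_component_singleton)
  then have "indep_vars (\<lambda>_. count_space UNIV) (\<lambda>w. X (t # w)) menger_index"
    by simp
  then show "bernoulli_labels M p (\<lambda>w. X (t # w))"
    using distr_label mem unfolding bernoulli_labels_def menger_index_def[symmetric] by simp
qed (rule p01)+

text \<open>The label of \<open>[t]\<close> and the labels of the longer words starting with
  \<open>t\<close> form disjoint blocks, hence are independent.\<close>

lemma branch_prob:
  assumes t: "t \<in> menger_T" and Q: "label_event Q"
  shows "prob {\<omega> \<in> space M. X [t] \<omega> \<and> Q (\<lambda>w. X (t # w) \<omega>)} = p * label_prob p Q"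
proof -
  interpret shift: menger_labels M p "\<lambda>w. X (t # w)" by (rule shift_labels) fact
  have mem: "[t] \<in> menger_index" "\<And>w. w \<in> menger_index \<Longrightarrow> t # w \<in> menger_index"
    using t by (auto simp: mem_menger_index)
  let ?K = "(#) t ` menger_index"
  let ?Y = "\<lambda>\<omega>. \<lambda>v\<in>?K. X v \<omega>"
  let ?Z = "\<lambda>\<omega>. \<lambda>v\<in>{[t]}. X v \<omega>"
  let ?B = "{x \<in> space (\<Pi>\<^sub>M v\<in>?K. count_space UNIV). Q (\<lambda>w. x (t # w))}"
  let ?A = "{x \<in> space (\<Pi>\<^sub>M v\<in>{[t]}. count_space (UNIV :: bool set)). x [t]}"
  have indep: "indep_var (\<Pi>\<^sub>M v\<in>{[t]}. count_space UNIV) ?Z (\<Pi>\<^sub>M v\<in>?K. count_space UNIV) ?Y"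
    using mem by (intro indep_var_restrict[OF indep_labels]) (auto simp: mem_menger_index)
  have Q_restrict: "Q (\<lambda>w. ?Y \<omega> (t # w)) \<longleftrightarrow> Q (\<lambda>w. X (t # w) \<omega>)" for \<omega>
    by (intro label_event_cong[OF Q]) simp
  have A: "?Z -` ?A \<inter> space M = {\<omega> \<in> space M. X [t] \<omega>}"
    by (auto simp: space_PiM)
  have B: "?Y -` ?B \<inter> space M = {\<omega> \<in> space M. Q (\<lambda>w. X (t # w) \<omega>)}"
    using Q_restrict by (auto simp: space_PiM)
  have "{\<omega> \<in> space M. X [t] \<omega> \<and> Q (\<lambda>w. X (t # w) \<omega>)}
     = (\<lambda>\<omega>. (?Z \<omega>, ?Y \<omega>)) -` (?A \<times> ?B) \<inter> space M"
    using A B by blast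
  also have "prob \<dots> = prob {\<omega> \<in> space M. X [t] \<omega>} * prob {\<omega> \<in> space M. Q (\<lambda>w. X (t # w) \<omega>)}"
    using indep_varD[OF indep sets_coordinate[of "[t]" "{[t]}"]
        sets_shifted[OF Q, of t "(#) t ` menger_index"]]
    by (simp only: A B) simp
  also have "\<dots> = p * label_prob p Q"
    using prob_label mem shift.event_labels(2)[OF Q] by simp
  finally show ?thesis .
qed

text \<open>Words with different first letters form disjoint blocks, so the branches are
  independent. The event may depend on \<open>t\<close>, as covering a cell asks for a different
  shifted cell in each branch.\<close>

lemma branching_prob:
  assumes Q: "\<And>t. t \<in> menger_T \<Longrightarrow> label_event (Q t)"
  shows "prob {\<omega> \<in> space M. \<forall>t\<in>menger_T. \<not> (X [t] \<omega> \<and> Q t (\<lambda>w. X (t # w) \<omega>))}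
    = (\<Prod>t\<in>menger_T. 1 - p * label_prob p (Q t))"
proof -
  define K where "K t = insert [t] ((#) t ` menger_index)" for t
  let ?Y = "\<lambda>t \<omega>. \<lambda>v\<in>K t. X v \<omega>"
  let ?S = "\<lambda>t. \<Pi>\<^sub>M v\<in>K t. count_space (UNIV :: bool set)"
  define B where "B t = {x \<in> space (?S t). \<not> (x [t] \<and> Q t (\<lambda>w. x (t # w)))}" for t
  have K: "[t] \<in> K t" "(#) t ` menger_index \<subseteq> K t" for t
    by (auto simp: K_def)
  have indep: "indep_vars ?S ?Y menger_T"
    by (intro indep_vars_restrict[OF indep_labels])
      (auto simp: K_def mem_menger_index disjoint_family_on_def)
  have B: "B t \<in> sets (?S t)" if "t \<in> menger_T" for t
    unfolding B_def
    by (intro sets.sets_Collect_neg sets.sets_Collect_conj sets_coordinate sets_shifted Q that K)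
  have pre: "?Y t -` B t \<inter> space M = {\<omega> \<in> space M. \<not> (X [t] \<omega> \<and> Q t (\<lambda>w. X (t # w) \<omega>))}"
    if "t \<in> menger_T" for t
  proof -
    have "Q t (\<lambda>w. ?Y t \<omega> (t # w)) \<longleftrightarrow> Q t (\<lambda>w. X (t # w) \<omega>)" for \<omega>
      by (intro label_event_cong[OF Q[OF that]]) (simp add: K_def)
    then show ?thesis by (auto simp: B_def space_PiM K)
  qed
  have prob_pre: "prob (?Y t -` B t \<inter> space M) = 1 - p * label_prob p (Q t)" if "t \<in> menger_T" for t
  proof -
    interpret shift: menger_labels M p "\<lambda>w. X (t # w)" by (rule shift_labels) fact
    have "[t] \<in> menger_index" using that by (simp add: mem_menger_index)
    then have "{\<omega> \<in> space M. X [t] \<omega>} \<in> events"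
      using measurable_sets[OF measurable_label, of "[t]" "{True}"]
      by (simp add: vimage_def Int_def conj_commute)
    then have "{\<omega> \<in> space M. X [t] \<omega> \<and> Q t (\<lambda>w. X (t # w) \<omega>)} \<in> events"
      using shift.event_labels(1)[OF Q[OF that]] by (intro sets.sets_Collect_conj)
    then show ?thesis
      unfolding pre[OF that] using branch_prob[OF that Q[OF that]]
      by (subst prob_neg) simp_all
  qed
  have ne: "menger_T \<noteq> {}" using card_menger_T by auto
  have "{\<omega> \<in> space M. \<forall>t\<in>menger_T. \<not> (X [t] \<omega> \<and> Q t (\<lambda>w. X (t # w) \<omega>))}
      = (\<Inter>t\<in>menger_T. ?Y t -` B t \<inter> space M)"
    using ne pre by auto
  also have "prob \<dots> = (\<Prod>t\<in>menger_T. prob (?Y t -` B t \<inter> space M))"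
    using indep_varsD_finite[OF indep ne _ B] by simp
  also have "\<dots> = (\<Prod>t\<in>menger_T. 1 - p * label_prob p (Q t))"
    by (intro prod.cong refl prob_pre)
  finally show ?thesis .
qed

lemma label_prob_branching:
  assumes P: "label_event P" and Q: "\<And>t. t \<in> menger_T \<Longrightarrow> label_event (Q t)"
    and rec: "\<And>x. P x \<longleftrightarrow> (\<forall>t\<in>menger_T. \<not> (x [t] \<and> Q t (\<lambda>w. x (t # w))))"
  shows "label_prob p P = (\<Prod>t\<in>menger_T. 1 - p * label_prob p (Q t))"
  using event_labels(2)[OF P] branching_prob[of Q] Q by (simp add: rec)

end

section \<open>Positive length\<close>

text \<open>Each factor is at most \<open>exp (- x i)\<close>, and
  \<open>exp (- S) \<le> 1 / (1 + S)\<close> for the total sum \<open>S\<close>.\<close>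

lemma sum_ratio_le_one_minus_prod:
  fixes x :: "'a \<Rightarrow> real"
  assumes "finite A" and x: "\<And>i. i \<in> A \<Longrightarrow> 0 \<le> x i" "\<And>i. i \<in> A \<Longrightarrow> x i \<le> 1"
  shows "sum x A / (1 + sum x A) \<le> 1 - (\<Prod>i\<in>A. 1 - x i)"
proof -
  have s: "0 \<le> sum x A" using x by (intro sum_nonneg)
  have "(\<Prod>i\<in>A. 1 - x i) \<le> (\<Prod>i\<in>A. exp (- x i))"
    using x exp_ge_add_one_self[of "- x _"] by (intro prod_mono) auto
  also have "\<dots> = exp (- sum x A)"
    using assms(1) by (simp add: exp_sum sum_negf[symmetric])
  also have "\<dots> \<le> 1 / (1 + sum x A)"
    using exp_ge_add_one_self[of "sum x A"] s by (simp add: exp_minus field_simps)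
  finally have "1 - 1 / (1 + sum x A) \<le> 1 - (\<Prod>i\<in>A. 1 - x i)" by simp
  moreover have "1 - 1 / (1 + sum x A) = sum x A / (1 + sum x A)"
    using s by (simp add: field_simps)
  ultimately show ?thesis by simp
qed

lemma measure_shadow_le_3: "measure lborel (shadow n x) \<le> 3"
proof -
  have "measure lborel (shadow n x) \<le> measure lborel {0..3::real}"
    by (intro measure_mono_fmeasurable shadow_subset) (auto simp: fmeasurable_compact)
  then show ?thesis by simp
qed

lemma label_prob_neg:
  assumes "label_event P"
  shows "label_prob p (\<lambda>x. \<not> P x) = 1 - label_prob p P"
  unfolding label_prob_def using assms prob_space.prob_neg[OF prob_space_label_space]
  by (simp add: label_event_def)

lemma label_prob_covered_eq_0:
  assumes "\<not> (0 \<le> r \<and> r < 3 * 3 ^ n)"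
  shows "label_prob p (covered n r) = 0"
proof -
  have "{x \<in> space (label_space p). covered n r x} = {}"
    using assms covered_range[of n r] by auto
  then show ?thesis by (simp only: label_prob_def measure_empty)
qed

lemma label_prob_covered_0: "k < 3 \<Longrightarrow> label_prob p (covered 0 (int k)) = 1"
  by (simp add: label_prob_def covered_0 prob_space.prob_space[OF prob_space_label_space])

context menger_labels
begin

section \<open>Survival probabilities of cells and the expected length\<close>

lemma label_prob_covered_Suc:
  "label_prob p (covered (Suc n) r)
    = 1 - (\<Prod>t\<in>menger_T. 1 - p * label_prob p (covered n (r - 3 ^ n * digit t)))"
proof -
  have "label_prob p (\<lambda>x. \<not> covered (Suc n) r x)
    = (\<Prod>t\<in>menger_T. 1 - p * label_prob p (covered n (r - 3 ^ n * digit t)))"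
    by (rule label_prob_branching[OF label_event_neg[OF label_event_covered] label_event_covered])
      (simp add: covered_Suc)
  then show ?thesis by (simp add: label_prob_neg label_event_covered)
qed

lemma label_prob_covered_ge:
  "(\<Sum>t\<in>menger_T. p * label_prob p (covered n (r - 3 ^ n * digit t)))
     / (1 + (\<Sum>t\<in>menger_T. p * label_prob p (covered n (r - 3 ^ n * digit t))))
   \<le> label_prob p (covered (Suc n) r)"
  unfolding label_prob_covered_Suc
  using p01 label_prob_bounds
  by (intro sum_ratio_le_one_minus_prod) (auto intro: mult_le_one)

text \<open>Removing a letter with digit \<open>j\<close> sends the cell to index
  \<open>(3 * k + d - j) * 3 ^ n + u\<close>. Grouping the letters by digit produces the
  multiplicities \<open>digit_count\<close>, and only the leading parts 0, 1, 2 index cells that can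
  be covered.\<close>

lemma sum_label_prob_covered:
  assumes "k < 3" "d < 3" "u < 3 ^ n"
  shows "(\<Sum>t\<in>menger_T. label_prob p (covered n (int (k * 3 ^ Suc n + (d * 3 ^ n + u)) - 3 ^ n * digit t)))
    = (\<Sum>i<3. digit_count (3 * int k + int d - int i) * label_prob p (covered n (int (i * 3 ^ n + u))))"
proof -
  define \<psi> where "\<psi> z = label_prob p (covered n (z * 3 ^ n + int u))" for z :: int
  have zero: "\<psi> z = 0" if "z \<notin> {0, 1, 2}" for z
  proof -
    have "\<not> (0 \<le> z * 3 ^ n + int u \<and> z * 3 ^ n + int u < 3 * 3 ^ n)"
    proof (cases "z < 0")
      case True
      then have "z * 3 ^ n \<le> (- 1) * 3 ^ n" by (intro mult_right_mono) auto
      moreover have "int u < 3 ^ n" using assms(3) by (metis of_nat_less_iff of_nat_numeral of_nat_power)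
      ultimately show ?thesis by linarith
    next
      case False
      with that have "3 * 3 ^ n \<le> z * 3 ^ n" by (intro mult_right_mono) auto
      then show ?thesis by linarith
    qed
    then show ?thesis unfolding \<psi>_def by (rule label_prob_covered_eq_0)
  qed
  have "int (k * 3 ^ Suc n + (d * 3 ^ n + u)) - 3 ^ n * j = (3 * int k + int d - j) * 3 ^ n + int u" for j
    by (simp add: algebra_simps)
  then have "(\<Sum>t\<in>menger_T. label_prob p (covered n (int (k * 3 ^ Suc n + (d * 3 ^ n + u)) - 3 ^ n * digit t)))
    = (\<Sum>t\<in>menger_T. \<psi> (3 * int k + int d - digit t))"
    by (simp only: \<psi>_def)
  also have "\<dots> = (\<Sum>i<3. digit_count (3 * int k + int d - int i) * \<psi> (int i))"
  proof -
    have "k \<in> {0, 1, 2}" "d \<in> {0, 1, 2}" using assms by auto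
    then show ?thesis
      unfolding sum_menger_T[of "\<lambda>j. \<psi> (3 * int k + int d - j)"] sum_lessThan_3
      by (elim insertE emptyE) (simp_all add: digit_count_def zero)
  qed
  finally show ?thesis by (simp add: \<psi>_def)
qed

lemma survival:
  assumes "p > 288 powr (- (1/3))"
  shows "triadic_survival (\<lambda>n k u. label_prob p (covered n (int (k * 3 ^ n + u)))) p"
proof
  fix k d u n :: nat assume kdu: "k < 3" "d < 3" "u < 3 ^ n"
  show "p * (\<Sum>i<3. digit_count (3 * int k + int d - int i) * label_prob p (covered n (int (i * 3 ^ n + u))))
      / (1 + p * (\<Sum>i<3. digit_count (3 * int k + int d - int i) * label_prob p (covered n (int (i * 3 ^ n + u)))))
    \<le> label_prob p (covered (Suc n) (int (k * 3 ^ Suc n + (d * 3 ^ n + u))))"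
    using label_prob_covered_ge[of n "int (k * 3 ^ Suc n + (d * 3 ^ n + u))"]
    unfolding sum_distrib_left[symmetric] sum_label_prob_covered[OF kdu] .
qed (use assms p01 in \<open>auto simp: label_prob_covered_0 label_prob_bounds\<close>)

text \<open>The lower bound on averaged survival probabilities bounds the expected number of covered
  cells by a multiple of \<open>3 ^ n\<close> from below, and each covered cell has length
  \<open>1 / 3 ^ n\<close>.\<close>

lemma expected_shadow:
  assumes "p > 288 powr (- (1/3))"
  obtains c where "0 < c" "\<And>n. c \<le> (\<integral>x. measure lborel (shadow n x) \<partial>label_space p)"
proof -
  interpret N: prob_space "label_space p" by (rule prob_space_label_space)
  interpret triadic_survival "\<lambda>n k u. label_prob p (covered n (int (k * 3 ^ n + u)))" p
    using assms by (rule survival)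
  obtain c where c: "0 < c" and ge: "\<And>n. c * 3 ^ n \<le> (\<Sum>u<3 ^ n. label_prob p (covered n (int (0 * 3 ^ n + u)))
      + label_prob p (covered n (int (1 * 3 ^ n + u))) + label_prob p (covered n (int (2 * 3 ^ n + u))))"
    by (rule survival_average) blast
  have "c \<le> (\<integral>x. measure lborel (shadow n x) \<partial>label_space p)" for n
  proof -
    have ev: "{x \<in> space (label_space p). covered n r x} \<in> sets (label_space p)" for r
      using label_event_covered by (simp add: label_event_def)
    have prob_eq: "(\<integral>x. of_bool (covered n r x) \<partial>label_space p) = label_prob p (covered n r)" for r
    proof -
      have "(\<integral>x. (of_bool (covered n r x) :: real) \<partial>label_space p)
          = (\<integral>x. indicator {x \<in> space (label_space p). covered n r x} x \<partial>label_space p)"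
        by (intro Bochner_Integration.integral_cong) (auto simp: indicator_def)
      then show ?thesis using ev by (simp add: label_prob_def)
    qed
    have meas: "(\<lambda>x. measure lborel (shadow n x)) \<in> borel_measurable (label_space p)"
      unfolding shadow_def by (rule surv_comp_measurable) simp
    have int_cov: "integrable (label_space p) (\<lambda>x. of_bool (covered n r x) :: real)" for r
    proof (rule N.integrable_const_bound[where B = 1])
      show "(\<lambda>x. of_bool (covered n r x) :: real) \<in> borel_measurable (label_space p)"
        unfolding covered_def by (rule surv_comp_measurable) simp
    qed simp
    have int_shadow: "integrable (label_space p) (\<lambda>x. measure lborel (shadow n x))"
    proof (rule N.integrable_const_bound[where B = 3])
      show "AE x in label_space p. norm (measure lborel (shadow n x)) \<le> 3"
        by (simp add: measure_shadow_le_3)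
    qed (rule meas)
    have "c * 3 ^ n \<le> (\<Sum>r<3 ^ Suc n. label_prob p (covered n (int r)))"
      using ge[of n] unfolding sum_triadic sum_lessThan_3 by (simp add: sum.distrib)
    also have "\<dots> = (\<integral>x. (\<Sum>r<3 ^ Suc n. of_bool (covered n (int r) x)) \<partial>label_space p)"
      by (simp only: prob_eq Bochner_Integration.integral_sum[OF int_cov])
    also have "\<dots> \<le> (\<integral>x. 3 ^ n * measure lborel (shadow n x) \<partial>label_space p)"
      by (intro integral_mono measure_shadow_ge Bochner_Integration.integrable_sum
          integrable_mult_right int_shadow int_cov)
    also have "\<dots> = 3 ^ n * (\<integral>x. measure lborel (shadow n x) \<partial>label_space p)"
      by simp
    finally show ?thesis by (simp add: mult.commute)
  qed
  with c show thesis by (rule that)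
qed

text \<open>If the lengths vanished almost surely, dominated convergence with the bound 3 would send
  their expectations to 0, against the uniform lower bound \<open>c\<close>.\<close>

lemma label_prob_vanishing_less_1:
  assumes "p > 288 powr (- (1/3))"
  shows "label_prob p vanishing < 1"
proof (rule ccontr)
  interpret N: prob_space "label_space p" by (rule prob_space_label_space)
  obtain c where c: "0 < c" "\<And>n. c \<le> (\<integral>x. measure lborel (shadow n x) \<partial>label_space p)"
    using expected_shadow[OF assms] by blast
  assume "\<not> label_prob p vanishing < 1"
  then have "label_prob p vanishing = 1"
    using label_prob_bounds(2)[of p vanishing] by linarith
  then have "N.prob {x \<in> space (label_space p). vanishing x} = 1"
    by (simp only: label_prob_def)
  then have ae: "AE x in label_space p. vanishing x"
    using N.AE_prob_1 by fastforce
  have "(\<lambda>n. \<integral>x. measure lborel (shadow n x) \<partial>label_space p) \<longlonglongrightarrow> (\<integral>x. 0 \<partial>label_space p)"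
  proof (rule integral_dominated_convergence[where w = "\<lambda>_. 3"])
    show "(\<lambda>x. measure lborel (shadow n x)) \<in> borel_measurable (label_space p)" for n
      unfolding shadow_def by (rule surv_comp_measurable) simp
    show "AE x in label_space p. norm (measure lborel (shadow n x)) \<le> 3" for n
      by (simp add: measure_shadow_le_3)
    show "AE x in label_space p. (\<lambda>n. measure lborel (shadow n x)) \<longlonglongrightarrow> 0"
      using ae by (simp add: vanishing_def)
  qed simp_all
  then have "c \<le> 0"
    using c(2) by (intro LIMSEQ_le_const) auto
  with c(1) show False by simp
qed

section \<open>Fixed points of the offspring generating function\<close>

lemma label_prob_fixed_point:
  assumes "label_event P" "\<And>x. P x \<longleftrightarrow> (\<forall>t\<in>menger_T. \<not> (x [t] \<and> \<not> P (\<lambda>w. x (t # w))))"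
  shows "label_prob p P = (1 - p * (1 - label_prob p P)) ^ 20"
proof -
  have "label_prob p P = (\<Prod>t\<in>menger_T. 1 - p * label_prob p (\<lambda>x. \<not> P x))"
    by (rule label_prob_branching[OF assms(1) label_event_neg[OF assms(1)] assms(2)])
  then show ?thesis
    by (simp only: label_prob_neg[OF assms(1)] prod_constant card_menger_T)
qed

text \<open>The offspring generating function has only one fixed point below 1: dividing the fixed point
  equation by \<open>1 - q\<close> leaves a geometric sum that is strictly increasing in \<open>q\<close>.\<close>

lemma fixed_point_unique:
  fixes q e :: real
  assumes "0 \<le> e" "e \<le> q" "q < 1"
    and q: "q = (1 - p * (1 - q)) ^ 20" and e: "e = (1 - p * (1 - e)) ^ 20"
  shows "e = q"
proof (rule ccontr)
  assume "e \<noteq> q"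
  then have "e < q" using assms by simp
  define y z where "y = 1 - p * (1 - q)" and "z = 1 - p * (1 - e)"
  have geometric: "p * (\<Sum>i<20. (1 - p * (1 - r)) ^ i) = 1"
    if "r = (1 - p * (1 - r)) ^ 20" "r < 1" for r
  proof -
    have "1 - (1 - p * (1 - r)) ^ 20 = (p * (1 - r)) * (\<Sum>i<20. (1 - p * (1 - r)) ^ i)"
      by (subst one_diff_power_eq) simp
    then have "(1 - r) * (p * (\<Sum>i<20. (1 - p * (1 - r)) ^ i)) = 1 - (1 - p * (1 - r)) ^ 20"
      by (simp only: mult_ac)
    also have "\<dots> = (1 - r) * 1"
      by (subst that(1)[symmetric]) simp
    finally show ?thesis using that(2) by (subst (asm) mult_cancel_left) simp
  qed
  have z: "0 \<le> z" "z < y"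
    using p01 \<open>e < q\<close> assms(1-3) mult_le_one[of p "1 - e"] by (simp_all add: z_def y_def)
  have "(\<Sum>i<20. z ^ i) < (\<Sum>i<20. y ^ i)"
  proof (rule sum_strict_mono_ex1)
    show "\<forall>i\<in>{..<20}. z ^ i \<le> y ^ i" using z by (auto intro: power_mono)
    \<comment> \<open>The terms of exponent 0 agree, so strictness is taken from exponent 1.\<close>
    show "\<exists>i\<in>{..<20}. z ^ i < y ^ i" using z by (intro bexI[of _ 1]) auto
  qed simp
  then have "p * (\<Sum>i<20. z ^ i) < p * (\<Sum>i<20. y ^ i)" using p01 by simp
  moreover have "p * (\<Sum>i<20. y ^ i) = 1" "p * (\<Sum>i<20. z ^ i) = 1"
    using geometric[OF q] geometric[OF e] assms(2,3) by (simp_all add: y_def z_def)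
  ultimately show False by simp
qed

lemma label_prob_extinct_eq_vanishing:
  assumes "p > 288 powr (- (1/3))"
  shows "label_prob p extinct = label_prob p vanishing"
proof (rule fixed_point_unique)
  interpret N: prob_space "label_space p" by (rule prob_space_label_space)
  show "label_prob p extinct \<le> label_prob p vanishing"
    unfolding label_prob_def using label_event_vanishing extinct_imp_vanishing
    by (intro N.finite_measure_mono) (auto simp: label_event_def)
qed (rule label_prob_bounds label_prob_vanishing_less_1[OF assms]
    label_prob_fixed_point[OF label_event_vanishing vanishing_iff]
    label_prob_fixed_point[OF label_event_extinct extinct_iff])+

end

theorem theorem1p19:
  fixes M :: "'w measure" and p :: real and X :: "(real^3) list \<Rightarrow> 'w \<Rightarrow> bool"
  assumes "prob_space M"
    and "0 < p" and "p < 1"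
    and "bernoulli_labels M p X"
    and "p > (8 * 6 * 6) powr (- (1/3))"
  shows "as_given_non_extinction M X
           (\<lambda>\<omega>. emeasure lborel (proj111 ` random_menger X \<omega>) > 0)"
proof -
  interpret prob_space M by fact
  interpret menger_labels M p X
    using assms by unfold_locales
  have p: "p > 288 powr (- (1/3))"
    using assms(5) by simp
  define V where "V = {\<omega> \<in> space M. vanishing (\<lambda>w. X w \<omega>)}"
  define E where "E = {\<omega> \<in> space M. extinct (\<lambda>w. X w \<omega>)}"
  have VE: "V \<in> events" "E \<in> events" "prob V = prob E"
    using event_labels[OF label_event_vanishing] event_labels[OF label_event_extinct]
      label_prob_extinct_eq_vanishing[OF p] by (simp_all add: V_def E_def)
  \<comment> \<open>Nested events of equal probability differ by a null set, and
    \<open>V - E\<close> is the exceptional event.\<close>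
  have "E \<subseteq> V" using extinct_imp_vanishing by (auto simp: V_def E_def)
  then have "prob (V - E) = 0"
    using VE finite_measure_Diff by simp
  then have "V - E \<in> null_sets M"
    using VE by (auto simp: null_sets_def emeasure_eq_measure)
  also have "V - E = {\<omega> \<in> space M. non_extinct X \<omega> \<and> \<not> emeasure lborel (proj111 ` random_menger X \<omega>) > 0}"
    by (auto simp: V_def E_def non_extinct_def extinct_def surviving_eq proj111_random_menger vanishing_eq_null)
  finally show ?thesis
    by (simp add: as_given_non_extinction_def)
qed

end
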